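(* Let $U:\mathbb{R}^n\to\mathbb{R}$ be of class $C^2$ and let $\Omega\subset\mathbb{R}^n$ be a connected component of $\{x\in\mathbb{R}^n:U(x)>0\}$. Assume that $\partial\Omega=P$, where $P$ is a finite set of critical points of $U$ with at least two elements, and that, if $\Omega$ is unbounded, there are $r_0>0$ and a non-negative function $\sigma:[r_0,+\infty)\to\mathbb{R}$ such that $\int_{r_0}^{+\infty}\sigma(r)\,dr=+\infty$ and $\sqrt{U(x)}\geq\sigma(|x|)$ for all $x\in\Omega$ with $|x|\geq r_0$. Then for every $p_-\in P$ there exist $p_+\in P\setminus\{p_-\}$ and a heteroclinic connection between $p_-$ and $p_+$, that is, a map $u^*:\mathbb{R}\to\mathbb{R}^n$ such that $$\ddot u^*=\nabla U(u^* ),\qquad \tfrac12|\dot u^*|^2-U(u^* )=0\quad\text{on }\mathbb{R},\qquad \lim_{t\to\pm\infty}u^*(t)=p_\pm.$$ *)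

theory Defs
  imports "HOL-Analysis.Analysis"
begin

definition class_C2 :: "('a::real_normed_vector \<Rightarrow> 'b::real_normed_vector) \<Rightarrow> bool" where
  "class_C2 f \<longleftrightarrow>
     (\<exists>(f' :: 'a \<Rightarrow> 'a \<Rightarrow>\<^sub>L 'b) (f'' :: 'a \<Rightarrow> 'a \<Rightarrow>\<^sub>L ('a \<Rightarrow>\<^sub>L 'b)).
        (\<forall>x. (f has_derivative blinfun_apply (f' x)) (at x)) \<and>
        (\<forall>x. (f' has_derivative blinfun_apply (f'' x)) (at x)) \<and>
        continuous_on UNIV f'')"

(* An unspecified value where f is not differentiable. *)
definition gradient :: "('a::real_inner \<Rightarrow> real) \<Rightarrow> 'a \<Rightarrow> 'a" where
  "gradient f x = (THE D. GDERIV f x :> D)"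

definition critical_point :: "('a::real_inner \<Rightarrow> real) \<Rightarrow> 'a \<Rightarrow> bool" where
  "critical_point f x \<longleftrightarrow> GDERIV f x :> 0"

(* v is the velocity of u. The limits at minus and plus infinity are p and q,
   in this order. *)
definition heteroclinic_connection ::
    "('a::real_inner \<Rightarrow> real) \<Rightarrow> 'a \<Rightarrow> 'a \<Rightarrow> (real \<Rightarrow> 'a) \<Rightarrow> bool" where
  "heteroclinic_connection U p q u \<longleftrightarrow>
     (\<exists>v. (\<forall>t. (u has_vector_derivative v t) (at t)) \<and>
          (\<forall>t. (v has_vector_derivative gradient U (u t)) (at t)) \<and>
          (\<forall>t. 1/2 * (norm (v t))\<^sup>2 - U (u t) = 0)) \<and>
     (u \<longlongrightarrow> p) at_bot \<and> (u \<longlongrightarrow> q) at_top"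

end

(* Work with the action, the integral of |u'|^2/2 + U(u), of piecewise smooth curves on the real line
   that are eventually equal to p at -oo and to some other point q0 of P at +oo.  A minimizing sequence
   is equi-Hoelder-1/2 and, after translations that put the first exit from a small ball around p at
   time 0, has a pointwise convergent subsequence.  Its limit u stays bounded, because escape to
   infinity costs infinite action; comparing with compactly supported variations and letting n -> oo
   gives the weak form of u'' = grad U(u), hence a classical solution.  As U(u) is integrable, u converges
   to points of P at both ends: to p at -oo by the choice of the translations, and not to p at +oo, since
   otherwise cutting off the first excursion would save a fixed amount of action.  (The limit at +oo may
   differ from q0.)  The energy is constant, and it vanishes at +oo.

   If n >= 2, Omega is the complement of P, so U is nonnegative everywhere and vanishes exactly on P.  If
   n = 1, Omega is a bounded interval and U has to be modified outside of it. *)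

theory Submission
  imports Defs "HOL-Complex_Analysis.Great_Picard"
begin

section \<open>Curves of finite action\<close>

text \<open>The limit curve need not be a competitor: a minimizing sequence can linger longer and
  longer near an intermediate well, and its pointwise limit then keeps only the first leg. The
  action of the limit is therefore never compared with the infimum \<open>d\<close>. Minimality is
  used along the sequence only, in two ways that survive pointwise limits. In the first variation,
  integration by parts moves the derivative from the curve to the test function, so that only values
  of the curve remain and dominated convergence suffices; weak compactness and semicontinuity of the
  kinetic term do not enter. In the exclusion of a return to \<open>p\<close>, a late point of one
  member of the sequence is joined to \<open>p\<close> by a short segment. Escape to infinity is
  excluded by a proper function \<open>\<Phi>\<close> whose gradient is controlled by
  \<open>sqrt (2 * U)\<close>. For n >= 2 it is radial. The given \<open>\<sigma>\<close> is merely
  measurable, so its place is taken by the minimum of \<open>sqrt U\<close> over spheres, which is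
  continuous. For n = 1 the term added to \<open>U\<close> outside the interval supplies
  \<open>\<Phi>\<close>.\<close>

lemma GDERIV_vector_chain:
  assumes "GDERIV f (u t) :> D" "(u has_vector_derivative v) (at t within S)"
  shows "((\<lambda>s. f (u s)) has_vector_derivative v \<bullet> D) (at t within S)"
proof -
  have "((\<lambda>s. f (u s)) has_derivative (\<lambda>h. (h *\<^sub>R v) \<bullet> D)) (at t within S)"
    using has_derivative_compose[OF assms(2)[unfolded has_vector_derivative_def]
      assms(1)[unfolded gderiv_def]] .
  then show ?thesis by (simp add: has_vector_derivative_def)
qed

lemma GDERIV_imp_continuous_on:
  assumes "\<And>x. GDERIV f x :> D x"
  shows "continuous_on S f"
proof -
  have "(f has_derivative (\<lambda>h. h \<bullet> D x)) (at x)" for x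
    using assms[of x] by (simp only: gderiv_def)
  then show ?thesis
    by (intro continuous_at_imp_continuous_on ballI has_derivative_continuous)
qed

lemma integrable_combine3:
  fixes f :: "real \<Rightarrow> 'b::banach"
  assumes "f integrable_on {a..c}" "f integrable_on {c..d}" "f integrable_on {d..b}"
    "a \<le> c" "c \<le> d" "d \<le> b"
  shows "f integrable_on {a..b}"
  using assms Henstock_Kurzweil_Integration.integrable_combine[of a c d f]
    Henstock_Kurzweil_Integration.integrable_combine[of a d b f] by simp

definition piecewise_path :: "(real \<Rightarrow> 'a::euclidean_space) \<Rightarrow> (real \<Rightarrow> 'a) \<Rightarrow> bool" where
  "piecewise_path u v \<longleftrightarrow> continuous_on UNIV u \<and>
     (\<exists>S. finite S \<and> (\<forall>t. t \<notin> S \<longrightarrow> (u has_vector_derivative v t) (at t))) \<and>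
     (\<forall>a b. (\<lambda>t. (norm (v t))\<^sup>2) integrable_on {a..b})"

definition lagrangian ::
    "('a::euclidean_space \<Rightarrow> real) \<Rightarrow> (real \<Rightarrow> 'a) \<Rightarrow> (real \<Rightarrow> 'a) \<Rightarrow> real \<Rightarrow> real" where
  "lagrangian U u v t = 1/2 * (norm (v t))\<^sup>2 + U (u t)"

text \<open>\<open>B\<close> is an upper bound of the action, not its value.\<close>

definition connects ::
    "('a::euclidean_space \<Rightarrow> real) \<Rightarrow> 'a \<Rightarrow> 'a \<Rightarrow> real \<Rightarrow> (real \<Rightarrow> 'a) \<Rightarrow> (real \<Rightarrow> 'a) \<Rightarrow> bool" where
  "connects U p q B u v \<longleftrightarrow> piecewise_path u v \<and>
     (\<exists>T. (\<forall>t\<le>-T. u t = p) \<and> (\<forall>t\<ge>T. u t = q)) \<and>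
     (\<forall>a b. integral {a..b} (lagrangian U u v) \<le> B)"

lemma has_integral_velocity:
  assumes "piecewise_path u v" "a \<le> b"
  shows "(v has_integral u b - u a) {a..b}"
proof -
  from assms(1) obtain S where "finite S" "\<forall>t. t \<notin> S \<longrightarrow> (u has_vector_derivative v t) (at t)"
    and c: "continuous_on UNIV u" unfolding piecewise_path_def by blast
  then show ?thesis
    by (intro fundamental_theorem_of_calculus_interior_strong[OF _ assms(2)])
      (auto intro: continuous_on_subset)
qed

lemma piecewise_path_shift:
  assumes "piecewise_path u v"
  shows "piecewise_path (\<lambda>t. u (t + s)) (\<lambda>t. v (t + s))"
proof -
  from assms obtain S where S: "finite S" "\<forall>t. t \<notin> S \<longrightarrow> (u has_vector_derivative v t) (at t)"
    and c: "continuous_on UNIV u" and i: "\<And>a b. (\<lambda>t. (norm (v t))\<^sup>2) integrable_on {a..b}"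
    unfolding piecewise_path_def by blast
  have "((\<lambda>t. u (t + s)) has_vector_derivative v (t + s)) (at t)" if "t \<notin> (\<lambda>t. t - s) ` S" for t
  proof -
    have "t + s \<notin> S" using that by force
    then have "(u has_vector_derivative v (t + s)) (at (t + s))" using S by blast
    then show ?thesis
      using vector_diff_chain_at[of "\<lambda>t. t + s" 1 t u "v (t+s)"]
        has_vector_derivative_add[OF has_vector_derivative_id has_vector_derivative_const, of s "at t"]
      by (simp add: o_def)
  qed
  moreover have "(\<lambda>t. (norm (v (t + s)))\<^sup>2) integrable_on {a..b}" for a b
    using has_integral_shift_real_ivl[OF integrable_integral[OF i[of "a + s" "b + s"]], of s]
    by (auto simp: integrable_on_def)
  moreover have "continuous_on UNIV (\<lambda>t. u (t + s))"
    by (intro continuous_on_compose2[OF c] continuous_intros) auto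
  ultimately show ?thesis unfolding piecewise_path_def using S(1) by blast
qed

lemma connects_shift:
  assumes "connects U p q B u v"
  shows "connects U p q B (\<lambda>t. u (t + s)) (\<lambda>t. v (t + s))"
proof -
  from assms obtain T where T: "\<forall>t\<le>-T. u t = p" "\<forall>t\<ge>T. u t = q" unfolding connects_def by blast
  have "\<forall>t\<le>-(T + \<bar>s\<bar>). u (t + s) = p" "\<forall>t\<ge>T + \<bar>s\<bar>. u (t + s) = q"
    using T by auto
  moreover have "integral {a..b} (lagrangian U (\<lambda>t. u (t + s)) (\<lambda>t. v (t + s))) \<le> B" for a b
  proof -
    have "integral {a..b} (lagrangian U (\<lambda>t. u (t + s)) (\<lambda>t. v (t + s)))
        = integral {a+s..b+s} (lagrangian U u v)"
      using integral_shift_real_ivl[of "a + s" s "b + s" "lagrangian U u v"]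
      by (simp add: lagrangian_def[abs_def])
    then show ?thesis using assms unfolding connects_def by simp
  qed
  ultimately show ?thesis
    using assms piecewise_path_shift unfolding connects_def by blast
qed

text \<open>The bound on the gradient \<open>\<Psi>\<close> makes \<open>\<Phi>\<close> 1-Lipschitz for the Jacobi metric \<open>sqrt (2 * U) * norm dx\<close>,
  so that properness of \<open>\<Phi>\<close> confines curves of bounded action to a bounded set.\<close>

locale multiwell =
  fixes U :: "'a::euclidean_space \<Rightarrow> real" and G :: "'a \<Rightarrow> 'a"
    and \<Phi> :: "'a \<Rightarrow> real" and \<Psi> :: "'a \<Rightarrow> 'a" and P :: "'a set"
  assumes GDERIV_U: "GDERIV U x :> G x"
    and continuous_G: "continuous_on UNIV G"
    and U_nonneg: "0 \<le> U x"
    and U_eq_0_iff: "U x = 0 \<longleftrightarrow> x \<in> P"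
    and finite_P: "finite P"
    and GDERIV_\<Phi>: "GDERIV \<Phi> x :> \<Psi> x"
    and \<Psi>_le: "(norm (\<Psi> x))\<^sup>2 \<le> 2 * U x"
    and \<Phi>_proper: "bounded {x. \<Phi> x \<le> c}"
begin

lemma continuous_U: "continuous_on S U"
  using GDERIV_U GDERIV_imp_continuous_on by blast

lemma lagrangian_nonneg: "0 \<le> lagrangian U u v t"
  by (simp add: lagrangian_def U_nonneg)

lemma integrable_U:
  assumes "continuous_on UNIV u"
  shows "(\<lambda>t. U (u t)) integrable_on {a..b::real}"
  by (intro integrable_continuous_interval continuous_on_compose2[OF continuous_U[of UNIV]]
      continuous_on_subset[OF assms]) auto

lemma integrable_lagrangian:
  assumes "piecewise_path u v"
  shows "lagrangian U u v integrable_on {a..b}"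
  using assms integrable_U[of u] unfolding lagrangian_def[abs_def] piecewise_path_def
  by (intro integrable_add) (auto intro: integrable_on_cmult_left)

lemma integral_lagrangian_mono:
  assumes "piecewise_path u v" "{a..b} \<subseteq> {c..d}"
  shows "integral {a..b} (lagrangian U u v) \<le> integral {c..d} (lagrangian U u v)"
  using assms by (intro integral_subset_le integrable_lagrangian) (auto simp: lagrangian_nonneg)

lemma integral_U_le:
  assumes "piecewise_path u v"
  shows "integral {a..b} (\<lambda>t. U (u t)) \<le> integral {a..b} (lagrangian U u v)"
  using assms integrable_lagrangian[OF assms]
  by (intro integral_le integrable_U) (auto simp: piecewise_path_def lagrangian_def)

text \<open>Cauchy-Schwarz in time, read off from the nonnegative integral of
  \<open>(norm (v t - c))\<^sup>2\<close>, whose expansion involves only integrals already known to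
  exist. All Hoelder-1/2 estimates originate here.\<close>

lemma norm_diff_sq_le:
  assumes uv: "piecewise_path u v" and "a \<le> b" and B: "integral {a..b} (lagrangian U u v) \<le> B"
  shows "(norm (u b - u a))\<^sup>2 \<le> 2 * B * (b - a)"
proof (cases "a = b")
  case False
  define D where "D = b - a"
  have D: "D > 0" using assms(2) False by (simp add: D_def)
  \<comment> \<open>The mean velocity, the constant for which the expansion below is
    sharpest.\<close>
  define c where "c = (u b - u a) /\<^sub>R D"
  define K where "K = integral {a..b} (\<lambda>t. (norm (v t))\<^sup>2)"
  have iv: "(\<lambda>t. (norm (v t))\<^sup>2) integrable_on {a..b}" using uv by (simp add: piecewise_path_def)
  have "((\<lambda>t. (norm (v t))\<^sup>2 - 2 * (v t \<bullet> c) + (norm c)\<^sup>2) has_integral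
      K - 2 * ((u b - u a) \<bullet> c) + D * (norm c)\<^sup>2) {a..b}"
    unfolding K_def D_def
    using has_integral_const_real[of "(norm c)\<^sup>2" a b] assms(2)
    by (intro has_integral_add has_integral_diff has_integral_mult_right
        has_integral_linear[OF has_integral_velocity[OF uv] bounded_linear_inner_left, unfolded o_def] integrable_integral[OF iv]) auto
  moreover have "(norm (v t))\<^sup>2 - 2 * (v t \<bullet> c) + (norm c)\<^sup>2 = (norm (v t - c))\<^sup>2" for t
    by (simp add: power2_norm_eq_inner algebra_simps inner_commute)
  ultimately have "0 \<le> K - 2 * ((u b - u a) \<bullet> c) + D * (norm c)\<^sup>2"
    by (auto intro: has_integral_nonneg)
  moreover have "(u b - u a) \<bullet> c = (norm (u b - u a))\<^sup>2 / D"
    by (simp add: c_def power2_norm_eq_inner divide_simps)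
  moreover have "D * (norm c)\<^sup>2 = (norm (u b - u a))\<^sup>2 / D"
    using D by (simp add: c_def power_mult_distrib power_divide divide_simps power2_eq_square)
  ultimately have 1: "(norm (u b - u a))\<^sup>2 \<le> K * D" using D by (simp add: field_simps)
  have "1/2 * K \<le> integral {a..b} (lagrangian U u v)"
    unfolding K_def integral_mult_right[symmetric]
    by (intro integral_le integrable_lagrangian[OF uv] integrable_on_cmult_left[OF iv, simplified])
       (auto simp: lagrangian_def U_nonneg intro: integrable_on_cmult_left[OF iv, simplified])
  then have "K \<le> 2 * B" using B by simp
  then have "K * D \<le> 2 * B * D" using D by simp
  then show ?thesis using 1 by (simp add: D_def)
qed simp

text \<open>By Young's inequality the rate of change of \<open>\<Phi>\<close> along the curve is at
  most the Lagrangian.\<close>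

lemma \<Phi>_along_path_le:
  assumes "piecewise_path u v" "a \<le> b"
  shows "\<Phi> (u b) \<le> \<Phi> (u a) + integral {a..b} (lagrangian U u v)"
proof -
  from assms(1) obtain S where S: "finite S" "\<forall>t. t \<notin> S \<longrightarrow> (u has_vector_derivative v t) (at t)"
    and c: "continuous_on UNIV u" unfolding piecewise_path_def by blast
  have "((\<lambda>t. v t \<bullet> \<Psi> (u t)) has_integral \<Phi> (u b) - \<Phi> (u a)) {a..b}"
    using S GDERIV_vector_chain[OF GDERIV_\<Phi>]
    by (intro fundamental_theorem_of_calculus_interior_strong[OF S(1) assms(2)]
        continuous_on_compose2[OF GDERIV_imp_continuous_on[OF GDERIV_\<Phi>, of UNIV]]
        continuous_on_subset[OF c]) auto
  moreover have "v t \<bullet> \<Psi> (u t) \<le> lagrangian U u v t" for t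
  proof -
    have "v t \<bullet> \<Psi> (u t) \<le> norm (v t) * norm (\<Psi> (u t))" by (rule norm_cauchy_schwarz)
    also have "\<dots> \<le> 1/2 * (norm (v t))\<^sup>2 + 1/2 * (norm (\<Psi> (u t)))\<^sup>2"
      using sum_squares_bound[of "norm (v t)" "norm (\<Psi> (u t))"] by simp
    also have "\<dots> \<le> lagrangian U u v t" using \<Psi>_le[of "u t"] by (simp add: lagrangian_def)
    finally show ?thesis .
  qed
  ultimately have "\<Phi> (u b) - \<Phi> (u a) \<le> integral {a..b} (lagrangian U u v)"
    using has_integral_le integrable_integral[OF integrable_lagrangian[OF assms(1)]] by blast
  then show ?thesis by simp
qed

text \<open>Every competitor starts at \<open>p\<close>, so \<open>\<Phi> p + B\<close> bounds
  \<open>\<Phi>\<close> along all of it. One radius thus serves a whole minimizing sequence.\<close>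

lemma connects_bounded:
  obtains R where "\<And>u v t. connects U p q B u v \<Longrightarrow> norm (u t) \<le> R"
proof -
  have "\<Phi> (u t) \<le> \<Phi> p + B" if "connects U p q B u v" for u v t
  proof -
    from that obtain T where T: "\<forall>t\<le>-T. u t = p" and uv: "piecewise_path u v"
      and B: "\<And>a b. integral {a..b} (lagrangian U u v) \<le> B" unfolding connects_def by blast
    have "u (min t (-T)) = p" using T by simp
    then show ?thesis
      using \<Phi>_along_path_le[OF uv, of "min t (-T)" t] B[of "min t (-T)" t] by simp
  qed
  moreover obtain R where "\<forall>x\<in>{x. \<Phi> x \<le> \<Phi> p + B}. norm x \<le> R"
    using \<Phi>_proper bounded_iff by metis
  ultimately show ?thesis using that by blast
qed


text \<open>Everything before \<open>t1\<close> is replaced by rest at \<open>p\<close> followed by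
  a straight run of duration \<open>\<tau>\<close>; the last two summands of the new bound are the
  kinetic and potential cost of this run. Since nothing is asked of the start of \<open>u\<close>,
  the lemma produces a first competitor out of a constant curve, and it also removes an excursion
  from a given competitor.\<close>

lemma connects_splice:
  assumes uv: "piecewise_path u v" and Tq: "\<And>t. T \<le> t \<Longrightarrow> u t = q"
    and B: "\<And>b. integral {t1..b} (lagrangian U u v) \<le> B"
    and \<tau>: "\<tau> > 0" and p: "p \<in> P"
    and C: "\<And>x. x \<in> closed_segment p (u t1) \<Longrightarrow> U x \<le> C"
  obtains y w where "connects U p q (B + (norm (u t1 - p))\<^sup>2 / (2 * \<tau>) + \<tau> * C) y w"
proof -
  define \<Delta> where "\<Delta> = u t1 - p"
  \<comment> \<open>The \<open>max 0\<close> puts rest and run into one formula: the factor is 0 up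
    to \<open>t1 - \<tau>\<close> and reaches 1 at \<open>t1\<close>.\<close>
  define l where "l t = p + max 0 (1 + (t - t1) / \<tau>) *\<^sub>R \<Delta>" for t
  define y where "y t = (if t \<le> t1 then l t else u t)" for t
  define w where "w t = (if t \<le> t1 - \<tau> then 0 else if t \<le> t1 then \<Delta> /\<^sub>R \<tau> else v t)" for t
  from uv obtain S where S: "finite S" "\<And>t. t \<notin> S \<Longrightarrow> (u has_vector_derivative v t) (at t)"
    and c: "continuous_on UNIV u" and iv: "\<And>a b. (\<lambda>t. (norm (v t))\<^sup>2) integrable_on {a..b}"
    unfolding piecewise_path_def by blast
  have lp: "l t = p" if "t \<le> t1 - \<tau>" for t
    using that \<tau> by (simp add: l_def max_def field_simps)
  have ll: "l t = p + (1 + (t - t1) / \<tau>) *\<^sub>R \<Delta>" if "t1 - \<tau> \<le> t" for t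
    using that \<tau> by (simp add: l_def max_def field_simps)
  have l1: "l t1 = u t1" using ll[of t1] \<tau> by (simp add: \<Delta>_def)
  have cy: "continuous_on UNIV y"
  proof -
    have "continuous_on ({..t1} \<union> {t1..}) (\<lambda>t. if t \<le> t1 then l t else u t)"
    proof (rule continuous_on_If)
      show "continuous_on {..t1} l" unfolding l_def by (intro continuous_intros) (use \<tau> in auto)
      show "continuous_on {t1..} u" using c continuous_on_subset by blast
    qed (use l1 in auto)
    moreover have "{..t1} \<union> {t1..} = UNIV" by auto
    ultimately show ?thesis by (simp add: y_def[abs_def])
  qed
  have dy: "(y has_vector_derivative w t) (at t)" if t: "t \<notin> insert t1 (insert (t1 - \<tau>) S)" for t
  proof -
    consider "t < t1 - \<tau>" | "t1 - \<tau> < t" "t < t1" | "t1 < t" using t by force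
    then show ?thesis
    proof cases
      case 1
      have "((\<lambda>_. p) has_vector_derivative 0) (at t)" by simp
      then have "(y has_vector_derivative 0) (at t)"
        by (rule has_vector_derivative_transform_within_open[of _ _ _ "{..<t1 - \<tau>}"])
          (use 1 lp \<tau> in \<open>auto simp: y_def\<close>)
      then show ?thesis using 1 by (simp add: w_def)
    next
      case 2
      have "((\<lambda>t. p + (1 + (t - t1) / \<tau>) *\<^sub>R \<Delta>) has_vector_derivative \<Delta> /\<^sub>R \<tau>) (at t)"
        using \<tau> by (auto intro!: derivative_eq_intros simp: has_vector_derivative_def field_simps)
      then have "(y has_vector_derivative \<Delta> /\<^sub>R \<tau>) (at t)"
        by (rule has_vector_derivative_transform_within_open[of _ _ _ "{t1 - \<tau><..<t1}"])
          (use 2 ll in \<open>auto simp: y_def\<close>)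
      then show ?thesis using 2 by (simp add: w_def)
    next
      case 3
      have "(u has_vector_derivative v t) (at t)" using t S by blast
      then have "(y has_vector_derivative v t) (at t)"
        by (rule has_vector_derivative_transform_within_open[of _ _ _ "{t1<..}"])
          (use 3 in \<open>auto simp: y_def\<close>)
      then show ?thesis using 3 \<tau> by (simp add: w_def)
    qed
  qed
  have iw: "(\<lambda>t. (norm (w t))\<^sup>2) integrable_on {a..b}" for a b
  proof -
    define a' b' where "a' = min a (t1 - \<tau>)" and "b' = max b t1"
    have "(\<lambda>t. (norm (w t))\<^sup>2) integrable_on {a'..t1 - \<tau>}"
      by (rule integrable_spike_finite[of "{}" _ _ "\<lambda>_. 0"]) (auto simp: w_def)
    moreover have "(\<lambda>t. (norm (w t))\<^sup>2) integrable_on {t1 - \<tau>..t1}"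
      by (rule integrable_spike_finite[of "{t1 - \<tau>}" _ _ "\<lambda>_. (norm (\<Delta> /\<^sub>R \<tau>))\<^sup>2"]) (auto simp: w_def)
    moreover have "(\<lambda>t. (norm (w t))\<^sup>2) integrable_on {t1..b'}"
      by (rule integrable_spike_finite[of "{t1}", OF _ _ iv]) (use \<tau> in \<open>auto simp: w_def\<close>)
    ultimately have "(\<lambda>t. (norm (w t))\<^sup>2) integrable_on {a'..b'}"
      using \<tau> by (intro integrable_combine3[of _ a' "t1 - \<tau>" t1 b']) (auto simp: a'_def b'_def)
    then show ?thesis by (rule integrable_subinterval_real) (auto simp: a'_def b'_def)
  qed
  have yw: "piecewise_path y w"
    unfolding piecewise_path_def using cy dy iw S(1) by (meson finite_insert)
  have J: "integral {a..b} (lagrangian U y w) \<le> B + (norm (u t1 - p))\<^sup>2 / (2 * \<tau>) + \<tau> * C" for a b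
  proof -
    \<comment> \<open>Enlarging the interval to contain both break points can only increase the
      integral of the nonnegative Lagrangian.\<close>
    define a' b' where "a' = min a (t1 - \<tau>)" and "b' = max b t1"
    have le: "a' \<le> t1 - \<tau>" "t1 - \<tau> \<le> t1" "a' \<le> t1" "t1 \<le> b'" using \<tau> by (auto simp: a'_def b'_def)
    note i = integrable_lagrangian[OF yw]
    have "integral {a..b} (lagrangian U y w) \<le> integral {a'..b'} (lagrangian U y w)"
      by (intro integral_lagrangian_mono[OF yw]) (auto simp: a'_def b'_def)
    also have "\<dots> = integral {a'..t1 - \<tau>} (lagrangian U y w) + integral {t1 - \<tau>..t1} (lagrangian U y w)
        + integral {t1..b'} (lagrangian U y w)"
      using Henstock_Kurzweil_Integration.integral_combine[OF le(3,4) i]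
        Henstock_Kurzweil_Integration.integral_combine[OF le(1,2) i] by simp
    also have "integral {a'..t1 - \<tau>} (lagrangian U y w) = 0"
      using p U_eq_0_iff[of p] \<tau> by (intro integral_unique has_integral_is_0) (auto simp: lagrangian_def w_def y_def lp)
    also have "integral {t1..b'} (lagrangian U y w) = integral {t1..b'} (lagrangian U u v)"
      by (rule integral_spike[of "{t1}"]) (use \<tau> in \<open>auto simp: lagrangian_def w_def y_def\<close>)
    also have "\<dots> \<le> B" by (rule B)
    also have "integral {t1 - \<tau>..t1} (lagrangian U y w)
        \<le> integral {t1 - \<tau>..t1} (\<lambda>_. (norm \<Delta>)\<^sup>2 / (2 * \<tau>\<^sup>2) + C)"
    proof (rule integral_le[OF i])
      fix t assume t: "t \<in> {t1 - \<tau>..t1}"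
      have "norm (w t) \<le> norm \<Delta> / \<tau>" using t \<tau> by (auto simp: w_def divide_simps)
      then have "(norm (w t))\<^sup>2 \<le> (norm \<Delta>)\<^sup>2 / \<tau>\<^sup>2"
        using power_mono[of "norm (w t)" "norm \<Delta> / \<tau>" 2] by (simp add: power_divide)
      moreover have "y t \<in> closed_segment p (u t1)"
      proof -
        have "y t = (1 - (1 + (t - t1) / \<tau>)) *\<^sub>R p + (1 + (t - t1) / \<tau>) *\<^sub>R u t1"
          using t ll[of t] by (simp add: y_def \<Delta>_def algebra_simps)
        moreover have "0 \<le> 1 + (t - t1) / \<tau>" "1 + (t - t1) / \<tau> \<le> 1" using t \<tau> by (auto simp: field_simps)
        ultimately show ?thesis unfolding in_segment by blast
      qed
      ultimately show "lagrangian U y w t \<le> (norm \<Delta>)\<^sup>2 / (2 * \<tau>\<^sup>2) + C"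
        using C[of "y t"] by (simp add: lagrangian_def)
    qed (rule integrable_const_ivl)
    also have "\<dots> = (norm \<Delta>)\<^sup>2 / (2 * \<tau>) + \<tau> * C"
      using \<tau> by (simp add: field_simps power2_eq_square)
    finally show ?thesis by (simp add: \<Delta>_def)
  qed
  have "\<forall>t\<le>-(\<bar>T\<bar> + \<bar>t1\<bar> + \<tau>). y t = p"
  proof (intro allI impI)
    fix t assume "t \<le> -(\<bar>T\<bar> + \<bar>t1\<bar> + \<tau>)"
    then have "t \<le> t1 - \<tau>" "t \<le> t1" using \<tau> by linarith+
    then show "y t = p" by (simp add: y_def lp)
  qed
  moreover have "\<forall>t\<ge>\<bar>T\<bar> + \<bar>t1\<bar> + \<tau>. y t = q"
  proof (intro allI impI)
    fix t assume "t \<ge> \<bar>T\<bar> + \<bar>t1\<bar> + \<tau>"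
    then have "t > t1" "t \<ge> T" using \<tau> by linarith+
    then show "y t = q" by (simp add: y_def Tq)
  qed
  ultimately have "connects U p q (B + (norm (u t1 - p))\<^sup>2 / (2 * \<tau>) + \<tau> * C) y w"
    using yw J unfolding connects_def by blast
  then show ?thesis by (rule that)
qed

text \<open>The constant curve \<open>q\<close> is spliced to the segment from \<open>p\<close> to
  \<open>q\<close>, traversed in unit time.\<close>

lemma connects_exists:
  assumes "p \<in> P" "q \<in> P"
  obtains B y w where "connects U p q B y w"
proof -
  have "compact (U ` closed_segment p q)"
    by (intro compact_continuous_image continuous_U compact_segment)
  then obtain C where C: "\<And>x. x \<in> closed_segment p q \<Longrightarrow> U x \<le> C"
    using bounded_imp_bdd_above[OF compact_imp_bounded] unfolding bdd_above_def by (metis imageI)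
  have "integral {0..b} (lagrangian U (\<lambda>_. q) (\<lambda>_. 0)) \<le> 0" for b :: real
    using U_eq_0_iff[of q] assms(2) by (simp add: lagrangian_def[abs_def])
  moreover have "piecewise_path (\<lambda>_. q) (\<lambda>_. 0)"
    unfolding piecewise_path_def by (auto intro!: exI[of _ "{}"])
  ultimately show ?thesis
    using connects_splice[of "\<lambda>_. q" "\<lambda>_. 0" 0 q 0 0 1 p C] C assms(1) that by simp metis
qed

text \<open>The mixed term \<open>v \<bullet> \<phi>1\<close> of the expanded kinetic energy is
  integrated by parts, so that no velocity is left in the bound and the inequality can pass to
  pointwise limits. Only \<open>\<phi>\<close>, not \<open>\<phi>1\<close>, vanishes at the ends:
  the varied curve may have kinks at \<open>a\<close> and \<open>b\<close>, and these account for
  the boundary terms.\<close>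

lemma connects_variation:
  assumes con: "connects U p q B u v" and ab: "a \<le> b"
    and low: "\<And>B' u' v'. connects U p q B' u' v' \<Longrightarrow> d \<le> B'"
    and \<phi>1: "\<And>t. t \<in> {a..b} \<Longrightarrow> (\<phi> has_vector_derivative \<phi>1 t) (at t within {a..b})"
    and \<phi>2: "\<And>t. t \<in> {a..b} \<Longrightarrow> (\<phi>1 has_vector_derivative \<phi>2 t) (at t within {a..b})"
    and c\<phi>2: "continuous_on {a..b} \<phi>2" and \<phi>0: "\<phi> a = 0" "\<phi> b = 0"
  shows "d \<le> B + s * (u b \<bullet> \<phi>1 b - u a \<bullet> \<phi>1 a - integral {a..b} (\<lambda>t. u t \<bullet> \<phi>2 t))
            + s\<^sup>2 / 2 * integral {a..b} (\<lambda>t. (norm (\<phi>1 t))\<^sup>2)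
            + integral {a..b} (\<lambda>t. U (u t + s *\<^sub>R \<phi> t) - U (u t))"
proof -
  from con have uv: "piecewise_path u v" and J: "\<And>a b. integral {a..b} (lagrangian U u v) \<le> B"
    and "\<exists>T. (\<forall>t\<le>-T. u t = p) \<and> (\<forall>t\<ge>T. u t = q)" unfolding connects_def by auto
  then obtain T where T: "\<forall>t\<le>-T. u t = p" "\<forall>t\<ge>T. u t = q" by blast
  from uv obtain S where S: "finite S" "\<And>t. t \<notin> S \<Longrightarrow> (u has_vector_derivative v t) (at t)"
    and c: "continuous_on UNIV u" and iv: "\<And>a b. (\<lambda>t. (norm (v t))\<^sup>2) integrable_on {a..b}"
    unfolding piecewise_path_def by blast
  define \<psi> where "\<psi> t = (if t \<in> {a..b} then s *\<^sub>R \<phi> t else 0)" for t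
  define \<psi>1 where "\<psi>1 t = (if t \<in> {a..b} then s *\<^sub>R \<phi>1 t else 0)" for t
  define y where "y t = u t + \<psi> t" for t
  define w where "w t = v t + \<psi>1 t" for t
  define K where "K = u b \<bullet> \<phi>1 b - u a \<bullet> \<phi>1 a - integral {a..b} (\<lambda>t. u t \<bullet> \<phi>2 t)"
  have c\<phi>: "continuous_on {a..b} \<phi>" "continuous_on {a..b} \<phi>1"
    using \<phi>1 \<phi>2 has_vector_derivative_continuous
    unfolding continuous_on_eq_continuous_within by blast+
  note cu = continuous_on_subset[OF c, of "{a..b}"]
  have at: "at t within {a..b} = at t" if "t \<in> {a<..<b}" for t
    using that by (intro at_within_interior) auto
  have v\<phi>: "((\<lambda>t. v t \<bullet> \<phi>1 t) has_integral K) {a..b}"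
  proof (rule integration_by_parts_interior_strong[OF bounded_bilinear_inner S(1) ab _ c\<phi>(2)])
    show "continuous_on {a..b} u" using cu by simp
    show "((\<lambda>t. u t \<bullet> \<phi>2 t) has_integral (u b \<bullet> \<phi>1 b - u a \<bullet> \<phi>1 a - K)) {a..b}"
      unfolding K_def using cu c\<phi>2
      by (auto intro!: integrable_integral integrable_continuous_interval continuous_intros)
    fix t assume t: "t \<in> {a<..<b} - S"
    show "(u has_vector_derivative v t) (at t)" using S(2) t by simp
    show "(\<phi>1 has_vector_derivative \<phi>2 t) (at t)" using \<phi>2[of t] at[of t] t by simp
  qed
  have i\<phi>: "(\<lambda>t. (norm (\<phi>1 t))\<^sup>2) integrable_on {a..b}"
    by (intro integrable_continuous_interval continuous_intros c\<phi>)
  have c\<psi>: "continuous_on UNIV \<psi>"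
  proof -
    have "continuous_on ({..a} \<union> {a..b} \<union> {b..}) \<psi>"
    proof (intro continuous_on_closed_Un)
      show "continuous_on {..a} \<psi>"
        by (rule continuous_on_eq[of _ "\<lambda>_. 0"]) (use \<phi>0 in \<open>auto simp: \<psi>_def\<close>)
      show "continuous_on {a..b} \<psi>"
        by (rule continuous_on_eq[of _ "\<lambda>t. s *\<^sub>R \<phi> t"]) (use c\<phi> in \<open>auto simp: \<psi>_def intro!: continuous_intros\<close>)
      show "continuous_on {b..} \<psi>"
        by (rule continuous_on_eq[of _ "\<lambda>_. 0"]) (use \<phi>0 in \<open>auto simp: \<psi>_def\<close>)
    qed auto
    moreover have "{..a} \<union> {a..b} \<union> {b..} = UNIV" by auto
    ultimately show ?thesis by simp
  qed
  have d\<psi>: "(\<psi> has_vector_derivative \<psi>1 t) (at t)" if ne: "t \<noteq> a" "t \<noteq> b" for t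
  proof -
    consider "t \<in> {a<..<b}" | "t \<in> - {a..b}"
      using ne by force
    then show ?thesis
    proof cases
      case 1
      then have "(\<phi> has_vector_derivative \<phi>1 t) (at t)" using \<phi>1[of t] at[of t] by auto
      then have "((\<lambda>t. s *\<^sub>R \<phi> t) has_vector_derivative s *\<^sub>R \<phi>1 t) (at t)"
        by (rule bounded_linear.has_vector_derivative[OF bounded_linear_scaleR_right])
      then have "(\<psi> has_vector_derivative s *\<^sub>R \<phi>1 t) (at t)"
        by (rule has_vector_derivative_transform_within_open[of _ _ _ "{a<..<b}"])
          (use 1 in \<open>auto simp: \<psi>_def\<close>)
      then show ?thesis using 1 by (simp add: \<psi>1_def)
    next
      case 2
      have "((\<lambda>_. 0) has_vector_derivative 0) (at t)" by simp
      then have "(\<psi> has_vector_derivative 0) (at t)"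
        by (rule has_vector_derivative_transform_within_open[of _ _ _ "- {a..b}"])
          (use 2 in \<open>auto simp: \<psi>_def\<close>)
      then show ?thesis using 2 by (auto simp: \<psi>1_def)
    qed
  qed
  have dy: "(y has_vector_derivative w t) (at t)" if "t \<notin> insert a (insert b S)" for t
    unfolding y_def w_def using that S(2)[of t] d\<psi>[of t] by (intro has_vector_derivative_add) auto
  have iw: "(\<lambda>t. (norm (w t))\<^sup>2) integrable_on {c..e}" for c e
  proof -
    \<comment> \<open>The increment of the squared speed; its mixed term is integrable by
      \<open>v\<phi>\<close>.\<close>
    define f where "f t = (if t \<in> {a..b} then 2 * s * (v t \<bullet> \<phi>1 t) + s\<^sup>2 * (norm (\<phi>1 t))\<^sup>2 else 0)" for t
    have "(\<lambda>t. 2 * s * (v t \<bullet> \<phi>1 t) + s\<^sup>2 * (norm (\<phi>1 t))\<^sup>2) integrable_on {a..b}"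
      using v\<phi> i\<phi> by (intro integrable_add integrable_on_mult_right) (auto simp: integrable_on_def)
    then have "f integrable_on UNIV"
      unfolding f_def by (subst integrable_restrict_UNIV)
    then have "f integrable_on {c..e}" by (rule integrable_on_subinterval) simp
    then have "(\<lambda>t. (norm (v t))\<^sup>2 + f t) integrable_on {c..e}"
      using iv by (intro integrable_add)
    moreover have "(norm (w t))\<^sup>2 = (norm (v t))\<^sup>2 + f t" for t
      unfolding power2_norm_eq_inner w_def \<psi>1_def f_def
      by (simp add: algebra_simps inner_commute power2_eq_square)
    ultimately show ?thesis by simp
  qed
  have cy: "continuous_on UNIV y"
    unfolding y_def by (intro continuous_intros c c\<psi>)
  have yw: "piecewise_path y w"
    unfolding piecewise_path_def using cy dy iw S(1) by (meson finite_insert)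
  define I where "I = s * K + s\<^sup>2 / 2 * integral {a..b} (\<lambda>t. (norm (\<phi>1 t))\<^sup>2)
            + integral {a..b} (\<lambda>t. U (u t + s *\<^sub>R \<phi> t) - U (u t))"
  define D where "D t = (if t \<in> {a..b} then s * (v t \<bullet> \<phi>1 t) + s\<^sup>2 / 2 * (norm (\<phi>1 t))\<^sup>2
            + (U (u t + s *\<^sub>R \<phi> t) - U (u t)) else 0)" for t
  have "((\<lambda>t. s * (v t \<bullet> \<phi>1 t) + s\<^sup>2 / 2 * (norm (\<phi>1 t))\<^sup>2
            + (U (u t + s *\<^sub>R \<phi> t) - U (u t))) has_integral I) {a..b}"
    unfolding I_def using cu c\<phi>(1)
    by (intro has_integral_add has_integral_mult_right v\<phi> integrable_integral[OF i\<phi>]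
        integrable_integral[OF integrable_continuous_interval] continuous_intros
        continuous_on_compose2[OF continuous_U[of UNIV]]) auto
  then have "(D has_integral I) {a..b}"
    by (rule has_integral_eq[rotated]) (simp add: D_def)
  then have D: "(D has_integral I) {c..e}" if "c \<le> a" "b \<le> e" for c e
    by (rule has_integral_on_superset) (use that in \<open>auto simp: D_def\<close>)
  have lag: "lagrangian U y w t = lagrangian U u v t + D t" for t
    unfolding lagrangian_def power2_norm_eq_inner D_def w_def y_def \<psi>_def \<psi>1_def
    by (simp add: algebra_simps inner_commute power2_eq_square)
  have "integral {c..e} (lagrangian U y w) \<le> B + I" for c e
  proof -
    have "integral {c..e} (lagrangian U y w) \<le> integral {min c a..max e b} (lagrangian U y w)"
      by (intro integral_lagrangian_mono[OF yw]) auto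
    also have "\<dots> = integral {min c a..max e b} (lagrangian U u v) + I"
      unfolding lag[abs_def] using D[of "min c a" "max e b"] integrable_lagrangian[OF uv]
      by (subst integral_add) (auto simp: integral_unique integrable_on_def)
    also have "\<dots> \<le> B + I" using J by simp
    finally show ?thesis .
  qed
  moreover have "\<exists>T. (\<forall>t\<le>-T. y t = p) \<and> (\<forall>t\<ge>T. y t = q)"
  proof -
    have "y t = p" if "t \<le> -(\<bar>T\<bar> + \<bar>a\<bar> + \<bar>b\<bar> + 1)" for t
    proof -
      have "t < a" "t \<le> -T" using that by linarith+
      then show ?thesis using T by (simp add: y_def \<psi>_def)
    qed
    moreover have "y t = q" if "t \<ge> \<bar>T\<bar> + \<bar>a\<bar> + \<bar>b\<bar> + 1" for t
    proof -
      have "b < t" "T \<le> t" using that by linarith+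
      then show ?thesis using T by (simp add: y_def \<psi>_def)
    qed
    ultimately show ?thesis by blast
  qed
  ultimately have "connects U p q (B + I) y w" using yw unfolding connects_def by blast
  then have "d \<le> B + I" by (rule low)
  then show ?thesis by (simp add: I_def K_def algebra_simps)
qed

end

section \<open>Limits of minimizing sequences\<close>

text \<open>Integrating twice and adding an affine function solves the two-point boundary value
  problem \<open>w'' = f\<close>. It yields both the comparison solution and the test function of
  the du Bois-Reymond argument.\<close>

lemma second_primitive:
  fixes f :: "real \<Rightarrow> 'a::euclidean_space"
  assumes "continuous_on {a..b} f" "a < b"
  obtains w w1 where
    "\<And>t. t \<in> {a..b} \<Longrightarrow> (w has_vector_derivative w1 t) (at t within {a..b})"
    "\<And>t. t \<in> {a..b} \<Longrightarrow> (w1 has_vector_derivative f t) (at t within {a..b})"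
    "w a = A" "w b = B"
proof -
  define f1 where "f1 t = integral {a..t} f" for t
  have f1: "(f1 has_vector_derivative f t) (at t within {a..b})" if "t \<in> {a..b}" for t
    unfolding f1_def by (rule integral_has_vector_derivative[OF assms(1) that])
  then have "continuous_on {a..b} f1"
    unfolding continuous_on_eq_continuous_within using has_vector_derivative_continuous by blast
  note f2 = integral_has_vector_derivative[OF this]
  define c where "c = (B - A - integral {a..b} f1) /\<^sub>R (b - a)"
  define w where "w t = A + integral {a..t} f1 + (t - a) *\<^sub>R c" for t
  have "w a = A" by (simp add: w_def)
  moreover have "w b = B" using assms(2) by (simp add: w_def c_def)
  moreover have "(w has_vector_derivative f1 t + c) (at t within {a..b})" if "t \<in> {a..b}" for t
    unfolding w_def by (rule derivative_eq_intros f2[OF that] refl | simp)+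
  moreover have "((\<lambda>t. f1 t + c) has_vector_derivative f t) (at t within {a..b})" if "t \<in> {a..b}" for t
    using f1[OF that] by (simp add: has_vector_derivative_add_const)
  ultimately show ?thesis using that[of w "\<lambda>t. f1 t + c"] by blast
qed

section \<open>The Euler-Lagrange equation of the limit curve\<close>

context multiwell
begin

text \<open>For fixed \<open>s\<close>, letting \<open>n\<close> tend to infinity in the variation
  inequality cancels \<open>d\<close>, because the bounds \<open>B n\<close> converge to it. What
  remains is a function \<open>F\<close> of \<open>s\<close> that is nonnegative, vanishes at 0 and
  is differentiable there; hence its derivative at 0 is zero.\<close>

lemma minimizing_limit_stationary:
  assumes con: "\<And>n. connects U p q (B n) (us n) (vs n)" and B: "B \<longlonglongrightarrow> d"
    and low: "\<And>B' u' v'. connects U p q B' u' v' \<Longrightarrow> d \<le> B'"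
    and R: "\<And>n t. norm (us n t) \<le> R" and conv: "\<And>t. (\<lambda>n. us n t) \<longlonglongrightarrow> u t"
    and cu: "continuous_on UNIV u" and ab: "a < b"
    and \<phi>1: "\<And>t. t \<in> {a..b} \<Longrightarrow> (\<phi> has_vector_derivative \<phi>1 t) (at t within {a..b})"
    and \<phi>2: "\<And>t. t \<in> {a..b} \<Longrightarrow> (\<phi>1 has_vector_derivative \<phi>2 t) (at t within {a..b})"
    and c\<phi>2: "continuous_on {a..b} \<phi>2" and \<phi>0: "\<phi> a = 0" "\<phi> b = 0"
  shows "u b \<bullet> \<phi>1 b - u a \<bullet> \<phi>1 a - integral {a..b} (\<lambda>t. u t \<bullet> \<phi>2 t)
           + integral {a..b} (\<lambda>t. \<phi> t \<bullet> G (u t)) = 0"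
proof -
  define N where "N = integral {a..b} (\<lambda>t. (norm (\<phi>1 t))\<^sup>2)"
  define K where "K = u b \<bullet> \<phi>1 b - u a \<bullet> \<phi>1 a - integral {a..b} (\<lambda>t. u t \<bullet> \<phi>2 t)"
  define H where "H s = integral {a..b} (\<lambda>t. U (u t + s *\<^sub>R \<phi> t) - U (u t))" for s
  have c\<phi>: "continuous_on {a..b} \<phi>"
    using \<phi>1 has_vector_derivative_continuous unfolding continuous_on_eq_continuous_within by blast
  have cu': "continuous_on {a..b} u" using cu continuous_on_subset by blast
  have cn: "continuous_on UNIV (us n)" for n using con[of n] by (auto simp: connects_def piecewise_path_def)
  have cn': "continuous_on {a..b} (us n)" for n using cn continuous_on_subset by blast
  have Kn: "(\<lambda>n. integral {a..b} (\<lambda>t. us n t \<bullet> \<phi>2 t)) \<longlonglongrightarrow> integral {a..b} (\<lambda>t. u t \<bullet> \<phi>2 t)"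
  proof (rule dominated_convergence(2)[where h = "\<lambda>t. R * norm (\<phi>2 t)"])
    show "(\<lambda>t. us n t \<bullet> \<phi>2 t) integrable_on {a..b}" for n
      by (intro integrable_continuous_interval continuous_intros cn' c\<phi>2)
    show "(\<lambda>t. R * norm (\<phi>2 t)) integrable_on {a..b}"
      by (intro integrable_continuous_interval continuous_intros c\<phi>2)
    show "norm (us n t \<bullet> \<phi>2 t) \<le> R * norm (\<phi>2 t)" for n t
      using Cauchy_Schwarz_ineq2[of "us n t" "\<phi>2 t"] mult_right_mono[OF R[of n t], of "norm (\<phi>2 t)"]
      by simp
    show "(\<lambda>n. us n t \<bullet> \<phi>2 t) \<longlonglongrightarrow> u t \<bullet> \<phi>2 t" for t by (intro tendsto_intros conv)
  qed
  \<comment> \<open>The dominating constant may depend on \<open>s\<close>, which is held fixed in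
    this limit.\<close>
  have Hn: "(\<lambda>n. integral {a..b} (\<lambda>t. U (us n t + s *\<^sub>R \<phi> t) - U (us n t))) \<longlonglongrightarrow> H s" for s
  proof -
    have "bounded (\<phi> ` {a..b})" by (intro compact_imp_bounded compact_continuous_image c\<phi>) auto
    then obtain M where M: "\<And>t. t \<in> {a..b} \<Longrightarrow> norm (\<phi> t) \<le> M"
      unfolding bounded_iff by (metis imageI)
    have "bounded (U ` cball 0 (R + \<bar>s\<bar> * M))"
      by (intro compact_imp_bounded compact_continuous_image continuous_U) auto
    then obtain C where C: "\<And>x. norm x \<le> R + \<bar>s\<bar> * M \<Longrightarrow> norm (U x) \<le> C"
      unfolding bounded_iff by (metis imageI mem_cball_0)
    show ?thesis unfolding H_def
    proof (rule dominated_convergence(2)[where h = "\<lambda>t. C + C"])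
      show "(\<lambda>t. U (us n t + s *\<^sub>R \<phi> t) - U (us n t)) integrable_on {a..b}" for n
        by (intro integrable_continuous_interval continuous_intros cn' c\<phi>
            continuous_on_compose2[OF continuous_U[of UNIV]]) auto
      show "(\<lambda>t. C + C) integrable_on {a..b}" by (rule integrable_const_ivl)
      show "norm (U (us n t + s *\<^sub>R \<phi> t) - U (us n t)) \<le> C + C" if t: "t \<in> {a..b}" for n t
      proof -
        have "norm (s *\<^sub>R \<phi> t) \<le> \<bar>s\<bar> * M" using M[OF t] by (simp add: mult_left_mono)
        moreover have "0 \<le> \<bar>s\<bar> * M" using order_trans[OF norm_ge_zero M[OF t]] by simp
        ultimately have "norm (us n t + s *\<^sub>R \<phi> t) \<le> R + \<bar>s\<bar> * M" "norm (us n t) \<le> R + \<bar>s\<bar> * M"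
          using R[of n t] norm_triangle_ineq[of "us n t" "s *\<^sub>R \<phi> t"] by linarith+
        then have "norm (U (us n t + s *\<^sub>R \<phi> t)) \<le> C" "norm (U (us n t)) \<le> C" using C by blast+
        then show ?thesis using norm_triangle_ineq4 by (meson add_mono order_trans)
      qed
      have "isCont U x" for x using continuous_U[of UNIV] by (simp add: continuous_on_eq_continuous_at)
      then show "(\<lambda>n. U (us n t + s *\<^sub>R \<phi> t) - U (us n t)) \<longlonglongrightarrow> U (u t + s *\<^sub>R \<phi> t) - U (u t)" for t
        by (intro tendsto_intros isCont_tendsto_compose[of _ U] conv)
    qed
  qed
  define F where "F s = s * K + s\<^sup>2 / 2 * N + H s" for s
  have F: "0 \<le> F s" for s
  proof -
    have "(\<lambda>n. B n + s * (us n b \<bullet> \<phi>1 b - us n a \<bullet> \<phi>1 a - integral {a..b} (\<lambda>t. us n t \<bullet> \<phi>2 t))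
            + s\<^sup>2 / 2 * N + integral {a..b} (\<lambda>t. U (us n t + s *\<^sub>R \<phi> t) - U (us n t)))
        \<longlonglongrightarrow> d + s * K + s\<^sup>2 / 2 * N + H s"
      unfolding K_def by (intro tendsto_intros B conv Kn Hn)
    then have "d \<le> d + s * K + s\<^sup>2 / 2 * N + H s"
    proof (rule LIMSEQ_le_const)
      show "\<exists>m. \<forall>n\<ge>m. d \<le> B n + s * (us n b \<bullet> \<phi>1 b - us n a \<bullet> \<phi>1 a - integral {a..b} (\<lambda>t. us n t \<bullet> \<phi>2 t))
            + s\<^sup>2 / 2 * N + integral {a..b} (\<lambda>t. U (us n t + s *\<^sub>R \<phi> t) - U (us n t))"
        unfolding N_def using connects_variation[OF con _ low \<phi>1 \<phi>2 c\<phi>2 \<phi>0] ab by simp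
    qed
    then show ?thesis by (simp add: F_def)
  qed
  have "(H has_vector_derivative integral (cbox a b) (\<lambda>t. \<phi> t \<bullet> G (u t + 0 *\<^sub>R \<phi> t))) (at 0 within UNIV)"
    unfolding H_def cbox_interval[symmetric]
  proof (rule leibniz_rule_vector_derivative)
    fix s t
    have "((\<lambda>s. u t + s *\<^sub>R \<phi> t) has_vector_derivative \<phi> t) (at s)"
      by (auto intro!: derivative_eq_intros simp: has_vector_derivative_def)
    then show "((\<lambda>s. U (u t + s *\<^sub>R \<phi> t) - U (u t)) has_vector_derivative \<phi> t \<bullet> G (u t + s *\<^sub>R \<phi> t)) (at s)"
      using GDERIV_vector_chain[OF GDERIV_U] by (simp add: has_vector_derivative_diff_const)
  next
    show "(\<lambda>t. U (u t + s *\<^sub>R \<phi> t) - U (u t)) integrable_on cbox a b" for s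
      unfolding cbox_interval
      by (intro integrable_continuous_interval continuous_intros cu' c\<phi>
            continuous_on_compose2[OF continuous_U[of UNIV]]) auto
    show "continuous_on (UNIV \<times> cbox a b) (\<lambda>(s, t). \<phi> t \<bullet> G (u t + s *\<^sub>R \<phi> t))"
      unfolding split_beta
      by (intro continuous_intros continuous_on_compose2[OF continuous_G]
          continuous_on_compose2[OF cu'] continuous_on_compose2[OF c\<phi>]) auto
  qed auto
  then have "(H has_real_derivative integral {a..b} (\<lambda>t. \<phi> t \<bullet> G (u t))) (at 0)"
    by (simp add: has_real_derivative_iff_has_vector_derivative)
  then have "(F has_real_derivative K + integral {a..b} (\<lambda>t. \<phi> t \<bullet> G (u t))) (at 0)"
    unfolding F_def by (auto intro!: derivative_eq_intros)
  moreover have "F 0 = 0" by (simp add: F_def H_def)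
  ultimately have "K + integral {a..b} (\<lambda>t. \<phi> t \<bullet> G (u t)) = 0"
    using DERIV_local_min[of F _ 0 1] F by simp
  then show ?thesis by (simp add: K_def)
qed

text \<open>du Bois-Reymond: the classical solution \<open>w\<close> of \<open>w'' = G u\<close> with the boundary values of \<open>u\<close>
  satisfies the same weak equation as \<open>u\<close>, and testing with \<open>\<phi>'' = u - w\<close> gives \<open>u = w\<close>.\<close>

lemma minimizing_limit_solves:
  assumes con: "\<And>n. connects U p q (B n) (us n) (vs n)" and B: "B \<longlonglongrightarrow> d"
    and low: "\<And>B' u' v'. connects U p q B' u' v' \<Longrightarrow> d \<le> B'"
    and R: "\<And>n t. norm (us n t) \<le> R" and conv: "\<And>t. (\<lambda>n. us n t) \<longlonglongrightarrow> u t"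
    and cu: "continuous_on UNIV u" and ab: "a < b"
  shows "\<exists>w1. \<forall>t\<in>{a..b}. (u has_vector_derivative w1 t) (at t within {a..b}) \<and>
    (w1 has_vector_derivative G (u t)) (at t within {a..b})"
proof -
  have cu': "continuous_on {a..b} u" using cu continuous_on_subset by blast
  have cG: "continuous_on {a..b} (\<lambda>t. G (u t))"
    by (intro continuous_on_compose2[OF continuous_G cu']) auto
  obtain w w1 where w: "\<And>t. t \<in> {a..b} \<Longrightarrow> (w has_vector_derivative w1 t) (at t within {a..b})"
    and w1: "\<And>t. t \<in> {a..b} \<Longrightarrow> (w1 has_vector_derivative G (u t)) (at t within {a..b})"
    and wab: "w a = u a" "w b = u b"
    using second_primitive[OF cG ab] by metis
  have cw: "continuous_on {a..b} w"
    using w has_vector_derivative_continuous unfolding continuous_on_eq_continuous_within by blast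
  define z where "z t = u t - w t" for t
  have cz: "continuous_on {a..b} z" unfolding z_def by (intro continuous_intros cw cu')
  obtain \<phi> \<phi>1 where \<phi>: "\<And>t. t \<in> {a..b} \<Longrightarrow> (\<phi> has_vector_derivative \<phi>1 t) (at t within {a..b})"
    and \<phi>1: "\<And>t. t \<in> {a..b} \<Longrightarrow> (\<phi>1 has_vector_derivative z t) (at t within {a..b})"
    and \<phi>0: "\<phi> a = 0" "\<phi> b = 0"
    using second_primitive[OF cz ab] by metis
  have c\<phi>: "continuous_on {a..b} \<phi>"
    using \<phi> has_vector_derivative_continuous unfolding continuous_on_eq_continuous_within by blast
  have st: "u b \<bullet> \<phi>1 b - u a \<bullet> \<phi>1 a - integral {a..b} (\<lambda>t. u t \<bullet> z t)
           + integral {a..b} (\<lambda>t. \<phi> t \<bullet> G (u t)) = 0"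
    by (rule minimizing_limit_stationary[of p q B us vs d R u, OF con B low R conv cu ab \<phi> \<phi>1 cz \<phi>0])
  \<comment> \<open>Green's identity for \<open>\<phi>\<close> and \<open>w\<close>, where
    \<open>\<phi>'' = z\<close> and \<open>w'' = G u\<close>. Since \<open>u\<close> and
    \<open>w\<close> agree at the ends, comparing it with \<open>st\<close> leaves only the integral
    of \<open>z \<bullet> z\<close>.\<close>
  have "((\<lambda>t. \<phi> t \<bullet> G (u t) - w t \<bullet> z t) has_integral
      (\<phi> b \<bullet> w1 b - w b \<bullet> \<phi>1 b) - (\<phi> a \<bullet> w1 a - w a \<bullet> \<phi>1 a)) {a..b}"
  proof (rule fundamental_theorem_of_calculus)
    fix t assume t: "t \<in> {a..b}"
    have 1: "((\<lambda>t. \<phi> t \<bullet> w1 t) has_vector_derivative \<phi> t \<bullet> G (u t) + \<phi>1 t \<bullet> w1 t) (at t within {a..b})"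
      by (rule bounded_bilinear.has_vector_derivative[OF bounded_bilinear_inner \<phi>[OF t] w1[OF t]])
    have 2: "((\<lambda>t. w t \<bullet> \<phi>1 t) has_vector_derivative w t \<bullet> z t + w1 t \<bullet> \<phi>1 t) (at t within {a..b})"
      by (rule bounded_bilinear.has_vector_derivative[OF bounded_bilinear_inner w[OF t] \<phi>1[OF t]])
    show "((\<lambda>t. \<phi> t \<bullet> w1 t - w t \<bullet> \<phi>1 t) has_vector_derivative \<phi> t \<bullet> G (u t) - w t \<bullet> z t) (at t within {a..b})"
      using has_vector_derivative_diff[OF 1 2] by (simp add: inner_commute)
  qed (use ab in auto)
  then have "integral {a..b} (\<lambda>t. \<phi> t \<bullet> G (u t) - w t \<bullet> z t) = - (u b \<bullet> \<phi>1 b) + u a \<bullet> \<phi>1 a"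
    using wab \<phi>0 by (simp add: integral_unique)
  moreover have i: "(\<lambda>t. \<phi> t \<bullet> G (u t)) integrable_on {a..b}" "(\<lambda>t. w t \<bullet> z t) integrable_on {a..b}"
      "(\<lambda>t. u t \<bullet> z t) integrable_on {a..b}"
    by (intro integrable_continuous_interval continuous_intros c\<phi> cG cw cz cu')+
  ultimately have "integral {a..b} (\<lambda>t. u t \<bullet> z t) - integral {a..b} (\<lambda>t. w t \<bullet> z t) = 0"
    using st by (simp add: integral_diff)
  then have "integral {a..b} (\<lambda>t. z t \<bullet> z t) = 0"
    unfolding integral_diff[OF i(3,2), symmetric] by (simp add: z_def inner_diff_left)
  moreover have "(\<lambda>t. z t \<bullet> z t) integrable_on {a..b}"
    by (intro integrable_continuous_interval continuous_intros cz)
  ultimately have "((\<lambda>t. z t \<bullet> z t) has_integral 0) (cbox a b)"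
    by (simp add: has_integral_iff)
  then have "z t \<bullet> z t = 0" if "t \<in> {a..b}" for t
    by (rule has_integral_0_cbox_imp_0[rotated 2])
      (use that ab cz in \<open>auto intro!: continuous_intros\<close>)
  then have uw: "u t = w t" if "t \<in> {a..b}" for t using that by (simp add: z_def)
  have "(u has_vector_derivative w1 t) (at t within {a..b})" if "t \<in> {a..b}" for t
    using has_vector_derivative_transform[OF that _ w[OF that]] uw by simp
  then show ?thesis using w1 by blast
qed

end

section \<open>Compactness of equi-Hoelder families and convergence at infinity\<close>

lemma holder_half_uniform:
  fixes u :: "real \<Rightarrow> 'a::real_normed_vector"
  assumes H: "\<And>s t. s \<le> t \<Longrightarrow> (norm (u t - u s))\<^sup>2 \<le> L * (t - s)" and "0 \<le> L" "0 < e"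
    and st: "\<bar>s - t\<bar> < e\<^sup>2 / (L + 1)"
  shows "norm (u s - u t) < e"
proof -
  have "(norm (u s - u t))\<^sup>2 \<le> L * \<bar>s - t\<bar>"
    using H[of s t] H[of t s] by (cases "s \<le> t") (auto simp: norm_minus_commute)
  \<comment> \<open>The \<open>+ 1\<close> keeps the divisor positive when
    \<open>L = 0\<close>.\<close>
  also have "\<dots> \<le> (L + 1) * \<bar>s - t\<bar>" by (intro mult_right_mono) auto
  also have "\<dots> < e\<^sup>2" using st \<open>0 \<le> L\<close> by (simp add: field_simps)
  finally show ?thesis using \<open>0 < e\<close> by (simp add: power2_less_imp_less)
qed

text \<open>Arzela-Ascoli in pointwise form: a diagonal subsequence converges at all rational times,
  and the common modulus of continuity carries the Cauchy property to every real time.\<close>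

lemma equi_holder_convergent_subsequence:
  fixes us :: "nat \<Rightarrow> real \<Rightarrow> 'a::euclidean_space"
  assumes R: "\<And>n t. norm (us n t) \<le> R"
    and H: "\<And>n s t. s \<le> t \<Longrightarrow> (norm (us n t - us n s))\<^sup>2 \<le> L * (t - s)" and L: "0 \<le> L"
  shows "\<exists>k u. strict_mono (k :: nat \<Rightarrow> nat) \<and> (\<forall>t. (\<lambda>n. us (k n) t) \<longlonglongrightarrow> u t)"
proof -
  obtain k where k: "strict_mono (k :: nat \<Rightarrow> nat)"
    and cr: "\<And>r. r \<in> (\<rat> :: real set) \<Longrightarrow> \<exists>l. (\<lambda>n. us (k n) r) \<longlonglongrightarrow> l"
    using function_convergent_subsequence[of \<rat> us R] R countable_rat by metis
  have "\<exists>l. (\<lambda>n. us (k n) t) \<longlonglongrightarrow> l" for t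
  proof -
    have "Cauchy (\<lambda>n. us (k n) t)"
    proof (rule metric_CauchyI)
      fix e :: real assume e: "0 < e"
      define \<delta> where "\<delta> = (e/3)\<^sup>2 / (L + 1)"
      have "0 < \<delta>" using e L by (simp add: \<delta>_def)
      then obtain r where r: "r \<in> \<rat>" "t < r" "r < t + \<delta>" using Rats_dense_in_real[of t "t + \<delta>"] by auto
      have near: "norm (us n t - us n r) < e/3" for n
        using r e by (intro holder_half_uniform[OF H L]) (auto simp: \<delta>_def)
      have "Cauchy (\<lambda>n. us (k n) r)" using cr[OF r(1)] LIMSEQ_imp_Cauchy by blast
      then obtain M where M: "\<And>m n. m \<ge> M \<Longrightarrow> n \<ge> M \<Longrightarrow> dist (us (k m) r) (us (k n) r) < e/3"
        using e unfolding Cauchy_def by (meson divide_pos_pos zero_less_numeral)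
      have "dist (us (k m) t) (us (k n) t) < e" if "m \<ge> M" "n \<ge> M" for m n
        using near[of "k m"] near[of "k n"] M[OF that] dist_triangle_third[of "us (k m) t" "us (k m) r" e "us (k n) r" "us (k n) t"]
        by (simp add: dist_norm norm_minus_commute)
      then show "\<exists>M. \<forall>m\<ge>M. \<forall>n\<ge>M. dist (us (k m) t) (us (k n) t) < e" by blast
    qed
    then show ?thesis using Cauchy_convergent convergent_def by blast
  qed
  then obtain u where "\<And>t. (\<lambda>n. us (k n) t) \<longlonglongrightarrow> u t" by metis
  with k show ?thesis by blast
qed

text \<open>Barbalat's lemma. A value of at least \<open>e\<close> forces \<open>f\<close> to stay
  above \<open>e/2\<close> for a time \<open>\<delta>/2\<close>, which adds
  \<open>\<delta> * e / 4\<close> to the primitive; beyond \<open>b0\<close> the primitive has less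
  than this left to gain.\<close>

lemma uniformly_continuous_integrable_tendsto_0:
  fixes f :: "real \<Rightarrow> real"
  assumes cf: "continuous_on UNIV f" and nonneg: "\<And>t. 0 \<le> f t"
    and unif: "\<And>e. 0 < e \<Longrightarrow> \<exists>\<delta>>0. \<forall>s t. \<bar>s - t\<bar> < \<delta> \<longrightarrow> \<bar>f s - f t\<bar> < e"
    and C: "\<And>b. integral {0..b} f \<le> C"
  shows "(f \<longlongrightarrow> 0) at_top"
proof -
  define F where "F b = integral {0..b} f" for b
  have i: "f integrable_on {a..b}" for a b
    using cf continuous_on_subset by (intro integrable_continuous_interval) blast
  have bdd: "bdd_above (F ` {0..})" using C by (auto simp: F_def bdd_above_def)
  define l where "l = Sup (F ` {0..})"
  have "eventually (\<lambda>t. f t < e) at_top" if e: "0 < e" for e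
  proof -
    obtain \<delta> where \<delta>: "0 < \<delta>" "\<And>s t. \<bar>s - t\<bar> < \<delta> \<Longrightarrow> \<bar>f s - f t\<bar> < e/2"
      using unif[of "e/2"] e by auto
    have "l - \<delta> * e / 4 < l" using \<delta> e by simp
    then obtain b0 where b0: "0 \<le> b0" "l - \<delta> * e / 4 < F b0"
      unfolding l_def using less_cSup_iff[OF _ bdd] by auto
    have "f t < e" if t: "b0 \<le> t" for t
    proof (rule ccontr)
      assume "\<not> f t < e"
      then have "e/2 \<le> f s" if "s \<in> {t..t + \<delta>/2}" for s
      proof -
        have "\<bar>s - t\<bar> < \<delta>" using that \<delta>(1) by auto
        then have "\<bar>f s - f t\<bar> < e/2" by (rule \<delta>(2))
        then show ?thesis using \<open>\<not> f t < e\<close> by linarith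
      qed
      then have "integral {t..t + \<delta>/2} (\<lambda>_. e/2) \<le> integral {t..t + \<delta>/2} f"
        by (intro integral_le i) auto
      then have "\<delta> * e / 4 \<le> integral {t..t + \<delta>/2} f" using \<delta>(1) by simp
      moreover have "F (t + \<delta>/2) = F t + integral {t..t + \<delta>/2} f"
        unfolding F_def using Henstock_Kurzweil_Integration.integral_combine[of 0 t "t + \<delta>/2" f] i t b0 \<delta>(1)
        by simp
      moreover have "F b0 \<le> F t"
        unfolding F_def using t b0 nonneg by (intro integral_subset_le i) auto
      moreover have "F (t + \<delta>/2) \<le> l"
        unfolding l_def using t b0 \<delta>(1) by (intro cSup_upper bdd) auto
      ultimately show False using b0 by linarith
    qed
    then show ?thesis unfolding eventually_at_top_linorder by blast
  qed
  then show ?thesis using nonneg by (auto simp: tendsto_iff)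
qed

text \<open>Late in time the curve lies in a union of disjoint balls, and connectedness of the image
  of the tail keeps it in a single one.\<close>

lemma tendsto_near_finite_set:
  fixes u :: "real \<Rightarrow> 'a::metric_space"
  assumes cu: "continuous_on UNIV u" and P: "finite P"
    and near: "\<And>e. 0 < e \<Longrightarrow> eventually (\<lambda>t. \<exists>p\<in>P. dist (u t) p < e) at_top"
  obtains p where "p \<in> P" "(u \<longlongrightarrow> p) at_top"
proof -
  \<comment> \<open>At most half the least distance between two points of \<open>P\<close>, which
    makes the balls disjoint; the 1 gives \<open>Min\<close> a nonempty set when \<open>P\<close>
    has a single point.\<close>
  define \<delta> where "\<delta> = Min (insert 1 ((\<lambda>(x, y). dist x y) ` {(x, y). x \<in> P \<and> y \<in> P \<and> x \<noteq> y})) / 2"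
  have "{(x, y). x \<in> P \<and> y \<in> P \<and> x \<noteq> y} \<subseteq> P \<times> P" by auto
  then have fin: "finite (insert 1 ((\<lambda>(x, y). dist x y) ` {(x, y). x \<in> P \<and> y \<in> P \<and> x \<noteq> y}))"
    using P finite_subset by fastforce
  have \<delta>: "0 < \<delta>" unfolding \<delta>_def using fin by (auto simp: Min_gr_iff)
  have sep: "2 * \<delta> \<le> dist x y" if "x \<in> P" "y \<in> P" "x \<noteq> y" for x y
    unfolding \<delta>_def using that by (auto intro!: Min_le[OF fin])
  obtain T where T: "\<And>t. T \<le> t \<Longrightarrow> \<exists>p\<in>P. dist (u t) p < \<delta>"
    using near[OF \<delta>] unfolding eventually_at_top_linorder by blast
  then obtain p where p: "p \<in> P" "dist (u T) p < \<delta>" by blast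
  have disj: "dist x y < \<delta> \<Longrightarrow> dist x p < \<delta> \<Longrightarrow> y \<in> P \<Longrightarrow> y = p" for x y
    using sep[of y p] p dist_triangle2[of y p x] by (fastforce simp: dist_commute)
  have stay: "dist (u t) p < \<delta>" if t: "T \<le> t" for t
  proof (rule ccontr)
    assume far: "\<not> dist (u t) p < \<delta>"
    define B where "B = (\<Union>y\<in>P - {p}. ball y \<delta>)"
    have "connected (u ` {T..})"
      by (intro connected_continuous_image continuous_on_subset[OF cu]) auto
    moreover have "open (ball p \<delta>)" "open B" by (auto simp: B_def)
    moreover have "ball p \<delta> \<inter> B \<inter> u ` {T..} = {}"
      using disj by (auto simp: B_def dist_commute)
    moreover have "u ` {T..} \<subseteq> ball p \<delta> \<union> B"
      using T by (fastforce simp: B_def dist_commute)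
    ultimately have "ball p \<delta> \<inter> u ` {T..} = {} \<or> B \<inter> u ` {T..} = {}"
      by (rule connectedD)
    moreover have "u T \<in> ball p \<delta> \<inter> u ` {T..}" using p by (auto simp: dist_commute)
    moreover have "u t \<in> B \<inter> u ` {T..}"
      using T[OF t] far t by (auto simp: B_def dist_commute)
    ultimately show False by blast
  qed
  have "(u \<longlongrightarrow> p) at_top"
  proof (rule tendstoI)
    fix e :: real assume e: "0 < e"
    have "eventually (\<lambda>t. \<exists>y\<in>P. dist (u t) y < min e \<delta>) at_top" using near[of "min e \<delta>"] e \<delta> by simp
    with eventually_ge_at_top[of T] show "eventually (\<lambda>t. dist (u t) p < e) at_top"
    proof eventually_elim
      case (elim t)
      then obtain y where y: "y \<in> P" "dist (u t) y < min e \<delta>" by blast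
      then have "y = p" using disj[of "u t" y] stay[OF elim(1)] by simp
      then show ?case using y by simp
    qed
  qed
  with p(1) show ?thesis by (rule that)
qed

text \<open>Compactness gives a least time on the sphere. If the curve were outside the ball before
  it, the intermediate value theorem would give a still earlier time on the sphere.\<close>

lemma first_exit_time:
  fixes u :: "real \<Rightarrow> 'a::real_normed_vector"
  assumes cu: "continuous_on UNIV u" and "0 \<le> \<rho>"
    and early: "\<And>t. t \<le> T0 \<Longrightarrow> u t = p" and "\<rho> \<le> norm (u T1 - p)"
  obtains s where "norm (u s - p) = \<rho>" "\<And>t. t \<le> s \<Longrightarrow> norm (u t - p) \<le> \<rho>"
proof -
  define f where "f t = norm (u t - p)" for t
  have cf: "continuous_on S f" for S
    unfolding f_def by (intro continuous_intros continuous_on_subset[OF cu]) auto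
  have f0: "f t = 0" if "t \<le> T0" for t using early[OF that] by (simp add: f_def)
  have ivt: "\<exists>x. min T0 t \<le> x \<and> x \<le> t \<and> f x = \<rho>" if "\<rho> \<le> f t" for t
    using IVT'[of f "min T0 t" \<rho> t] f0[of "min T0 t"] that cf \<open>0 \<le> \<rho>\<close> by auto
  define K where "K = {t \<in> {min T0 T1..max T0 T1}. f t = \<rho>}"
  have "K = {min T0 T1..max T0 T1} \<inter> f -` {\<rho>}" by (auto simp: K_def)
  then have "compact K"
    using continuous_closed_preimage[OF cf] compact_Int_closed[of "{min T0 T1..max T0 T1}"]
    by (metis closed_atLeastAtMost closed_singleton compact_Icc inf.left_idem)
  moreover have "K \<noteq> {}"
  proof -
    obtain x where "min T0 T1 \<le> x" "x \<le> T1" "f x = \<rho>" using ivt[of T1] assms(4) by (auto simp: f_def)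
    then have "x \<in> K" by (simp add: K_def)
    then show ?thesis by blast
  qed
  ultimately obtain s where s: "s \<in> K" "\<And>t. t \<in> K \<Longrightarrow> s \<le> t" using compact_attains_inf by metis
  have "f t \<le> \<rho>" if t: "t \<le> s" for t
  proof (rule ccontr)
    assume "\<not> f t \<le> \<rho>"
    then have gt: "\<rho> < f t" by simp
    then have "T0 < t" using f0[of t] \<open>0 \<le> \<rho>\<close> by force
    obtain x where x: "min T0 t \<le> x" "x \<le> t" "f x = \<rho>" using ivt[of t] gt by auto
    then have "x \<in> K" using s(1) t \<open>T0 < t\<close> by (auto simp: K_def)
    then have "s \<le> x" by (rule s(2))
    then have "x = t" using x t by simp
    then show False using x gt by simp
  qed
  then show ?thesis using that[of s] s(1) by (simp add: K_def f_def)
qed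

lemma compact_pos_lower_bound:
  fixes f :: "'a::topological_space \<Rightarrow> real"
  assumes "compact K" "continuous_on K f" "\<And>x. x \<in> K \<Longrightarrow> 0 < f x"
  obtains \<mu> where "0 < \<mu>" "\<And>x. x \<in> K \<Longrightarrow> \<mu> \<le> f x"
proof (cases "K = {}")
  case False
  then obtain x where "x \<in> K" "\<forall>y\<in>K. f x \<le> f y" using continuous_attains_inf[OF assms(1) _ assms(2)] by blast
  then show ?thesis using that[of "f x"] assms(3) by blast
qed (use that[of 1] in auto)

section \<open>Asymptotics, energy and nontriviality of the limit curve\<close>

context multiwell
begin

lemma G_eq_0:
  assumes "p \<in> P"
  shows "G p = 0"
proof -
  have "U p = 0" using U_eq_0_iff assms by blast
  then have "(\<lambda>h. h \<bullet> G p) = (\<lambda>_. 0)"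
    using GDERIV_U[of p] U_nonneg unfolding gderiv_def
    by (intro differential_zero_maxmin[of p UNIV U]) auto
  then have "G p \<bullet> G p = 0" by meson
  then show ?thesis by simp
qed

text \<open>\<open>U\<close> may decay at infinity, so small values locate a well only within a
  bounded region; there compactness gives a positive lower bound away from the wells.\<close>

lemma near_well:
  assumes "0 < e"
  obtains \<mu> where "0 < \<mu>" "\<And>x. norm x \<le> R \<Longrightarrow> U x < \<mu> \<Longrightarrow> \<exists>p\<in>P. dist x p < e"
proof -
  have "compact (cball 0 R - (\<Union>p\<in>P. ball p e))"
    by (intro compact_diff compact_cball open_UN ballI open_ball)
  moreover have "0 < U x" if "x \<in> cball 0 R - (\<Union>p\<in>P. ball p e)" for x
    using that assms U_eq_0_iff[of x] U_nonneg[of x] by force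
  ultimately obtain \<mu> where "0 < \<mu>" "\<And>x. x \<in> cball 0 R - (\<Union>p\<in>P. ball p e) \<Longrightarrow> \<mu> \<le> U x"
    using compact_pos_lower_bound continuous_U by metis
  then have "\<exists>p\<in>P. dist x p < e" if "norm x \<le> R" "U x < \<mu>" for x
    using that by (metis DiffI UN_E dist_commute linorder_not_le mem_ball mem_cball_0)
  with \<open>0 < \<mu>\<close> show ?thesis by (rule that)
qed

text \<open>Barbalat's lemma applies to \<open>U\<close> along the curve, because Hoelder continuity
  of \<open>u\<close> and compactness of its range make this function uniformly continuous. The
  other end is treated by applying the lemma to the reversed curve.\<close>

lemma tendsto_well:
  assumes cu: "continuous_on UNIV u" and R: "\<And>t. norm (u t) \<le> R"
    and H: "\<And>s t. s \<le> t \<Longrightarrow> (norm (u t - u s))\<^sup>2 \<le> L * (t - s)" and L: "0 \<le> L"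
    and C: "\<And>b. integral {0..b} (\<lambda>t. U (u t)) \<le> C"
  obtains q where "q \<in> P" "(u \<longlongrightarrow> q) at_top"
proof -
  have "((\<lambda>t. U (u t)) \<longlongrightarrow> 0) at_top"
  proof (rule uniformly_continuous_integrable_tendsto_0[OF _ U_nonneg _ C])
    show "continuous_on UNIV (\<lambda>t. U (u t))"
      by (intro continuous_on_compose2[OF continuous_U[of UNIV] cu]) auto
    fix e :: real assume e: "0 < e"
    have "uniformly_continuous_on (cball 0 R) U"
      by (intro compact_uniformly_continuous continuous_U compact_cball)
    then obtain \<eta> where \<eta>: "0 < \<eta>"
      "\<And>x y. x \<in> cball 0 R \<Longrightarrow> y \<in> cball 0 R \<Longrightarrow> dist x y < \<eta> \<Longrightarrow> dist (U x) (U y) < e"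
      unfolding uniformly_continuous_on_def using e by metis
    show "\<exists>\<delta>>0. \<forall>s t. \<bar>s - t\<bar> < \<delta> \<longrightarrow> \<bar>U (u s) - U (u t)\<bar> < e"
    proof (intro exI[of _ "\<eta>\<^sup>2 / (L + 1)"] conjI allI impI)
      fix s t assume "\<bar>s - t\<bar> < \<eta>\<^sup>2 / (L + 1)"
      then have "norm (u s - u t) < \<eta>" using holder_half_uniform[OF H L \<eta>(1)] by blast
      then show "\<bar>U (u s) - U (u t)\<bar> < e" using \<eta>(2)[of "u s" "u t"] R by (simp add: dist_norm)
    qed (use \<eta> L in auto)
  qed
  then have "eventually (\<lambda>t. \<exists>p\<in>P. dist (u t) p < e) at_top" if e: "0 < e" for e
  proof -
    obtain \<mu> where \<mu>: "0 < \<mu>" "\<And>x. norm x \<le> R \<Longrightarrow> U x < \<mu> \<Longrightarrow> \<exists>p\<in>P. dist x p < e"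
      using near_well[OF e] by metis
    have "eventually (\<lambda>t. U (u t) < \<mu>) at_top"
      using order_tendstoD(2)[OF \<open>((\<lambda>t. U (u t)) \<longlongrightarrow> 0) at_top\<close> \<mu>(1)] .
    then show ?thesis by eventually_elim (use \<mu> R in blast)
  qed
  from tendsto_near_finite_set[OF cu finite_P this] that show ?thesis by blast
qed


text \<open>The energy is constant, so its limit at infinity decides, and the point is that the
  velocity tends to 0. The acceleration \<open>G (u t)\<close> tends to 0, hence \<open>v t\<close>
  is close to \<open>u (t+1) - u t\<close>, which tends to 0 as \<open>u\<close> converges.\<close>

lemma zero_energy:
  assumes u: "\<And>t. (u has_vector_derivative v t) (at t)"
    and v: "\<And>t. (v has_vector_derivative G (u t)) (at t)"
    and q: "q \<in> P" and lim: "(u \<longlongrightarrow> q) at_top"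
  shows "1/2 * (norm (v t))\<^sup>2 - U (u t) = 0"
proof -
  define E where "E t = 1/2 * (v t \<bullet> v t) - U (u t)" for t
  have "(E has_real_derivative 0) (at t)" for t
  proof -
    have "((\<lambda>t. v t \<bullet> v t) has_vector_derivative v t \<bullet> G (u t) + G (u t) \<bullet> v t) (at t)"
      by (rule bounded_bilinear.has_vector_derivative[OF bounded_bilinear_inner v v])
    then have "((\<lambda>t. v t \<bullet> v t) has_real_derivative 2 * (v t \<bullet> G (u t))) (at t)"
      by (simp add: has_real_derivative_iff_has_vector_derivative inner_commute)
    moreover have "((\<lambda>t. U (u t)) has_real_derivative v t \<bullet> G (u t)) (at t)"
      using GDERIV_vector_chain[OF GDERIV_U u] by (simp add: has_real_derivative_iff_has_vector_derivative)
    ultimately show ?thesis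
      unfolding E_def by (auto intro!: derivative_eq_intros)
  qed
  then have E: "E s = E t" for s using DERIV_const_ratio_const[of s t E 0] DERIV_isconst_all by metis
  have isG: "isCont G x" "isCont U x" for x
    using continuous_G continuous_U[of UNIV] by (simp_all add: continuous_on_eq_continuous_at)
  have Glim: "((\<lambda>t. G (u t)) \<longlongrightarrow> 0) at_top"
    using isCont_tendsto_compose[OF isG(1) lim] G_eq_0[OF q] by simp
  have "(v \<longlongrightarrow> 0) at_top"
  proof (rule tendstoI)
    fix e :: real assume "0 < e"
    \<comment> \<open>Of the eight parts of \<open>e\<close>, three bound the change of velocity
      over unit time and two the displacement; five suffice.\<close>
    then have e: "0 < e/8" by simp
    have "eventually (\<lambda>t. dist (u t) q < e/8 \<and> dist (G (u t)) 0 < e/8) at_top"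
      using tendstoD[OF lim e] tendstoD[OF Glim e] by eventually_elim simp
    then obtain T where T: "\<And>t. T \<le> t \<Longrightarrow> dist (u t) q < e/8" "\<And>t. T \<le> t \<Longrightarrow> norm (G (u t)) < e/8"
      unfolding eventually_at_top_linorder by auto
    have "norm (v t) < e" if t: "T \<le> t" for t
    proof -
      have vs: "norm (v s - v t) \<le> 3 * (e/8)" if s: "s \<in> {t..t+1}" for s
      proof -
        have "norm (v s - v t - (s - t) *\<^sub>R G (u t)) \<le> norm (s - t) * (e/8 + e/8)"
        proof (rule vector_differentiable_bound_linearization[where S = "{t..t+1}"])
          show "(v has_vector_derivative G (u x)) (at x within {t..t+1})" for x
            using v has_vector_derivative_at_within by blast
          show "closed_segment t s \<subseteq> {t..t+1}" using s by (simp add: closed_segment_eq_real_ivl)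
          show "norm (G (u x) - G (u t)) \<le> e/8 + e/8" if "x \<in> {t..t+1}" for x
            using T(2)[of x] T(2)[of t] that t norm_triangle_ineq4[of "G (u x)" "G (u t)"] by auto
        qed auto
        also have "\<dots> \<le> 1 * (e/8 + e/8)" using s e by (intro mult_right_mono) auto
        finally have "norm (v s - v t - (s - t) *\<^sub>R G (u t)) \<le> 2 * (e/8)" by simp
        moreover have "norm ((s - t) *\<^sub>R G (u t)) \<le> 1 * (e/8)"
          unfolding norm_scaleR using s T(2)[OF t] e by (intro mult_mono) auto
        moreover have "norm (v s - v t) \<le> norm (v s - v t - (s - t) *\<^sub>R G (u t)) + norm ((s - t) *\<^sub>R G (u t))"
          using norm_triangle_ineq[of "v s - v t - (s - t) *\<^sub>R G (u t)" "(s - t) *\<^sub>R G (u t)"] by simp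
        ultimately show ?thesis by linarith
      qed
      have "norm (u (t+1) - u t - (t+1-t) *\<^sub>R v t) \<le> norm (t+1-t) * (3 * (e/8))"
      proof (rule vector_differentiable_bound_linearization[where S = "{t..t+1}"])
        show "(u has_vector_derivative v x) (at x within {t..t+1})" for x
          using u has_vector_derivative_at_within by blast
        show "closed_segment t (t+1) \<subseteq> {t..t+1}" by (simp add: closed_segment_eq_real_ivl)
      qed (use vs in auto)
      then have "norm (u (t+1) - u t - v t) \<le> 3 * (e/8)" by simp
      moreover have "norm (u (t+1) - u t) < e/8 + e/8"
        using T(1)[of t] T(1)[of "t+1"] t dist_triangle2[of "u (t+1)" "u t" q] by (simp add: dist_norm)
      moreover have "norm (v t) \<le> norm (u (t+1) - u t) + norm (u (t+1) - u t - v t)"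
        using norm_triangle_ineq4[of "u (t+1) - u t" "u (t+1) - u t - v t"] by simp
      ultimately show ?thesis using e by linarith
    qed
    then show "eventually (\<lambda>t. dist (v t) 0 < e) at_top"
      unfolding eventually_at_top_linorder by auto
  qed
  moreover have "((\<lambda>t. U (u t)) \<longlongrightarrow> 0) at_top"
    using isCont_tendsto_compose[OF isG(2) lim] U_eq_0_iff[of q] q by simp
  ultimately have "(E \<longlongrightarrow> 1/2 * (0 \<bullet> (0::'a)) - 0) at_top"
    unfolding E_def by (intro tendsto_intros)
  moreover have "(E \<longlongrightarrow> E t) at_top" by (intro tendsto_eventually always_eventually allI E)
  ultimately have "E t = 0" using tendsto_unique[of at_top E "1/2 * (0 \<bullet> (0::'a)) - 0" "E t"] by simp
  then show ?thesis by (simp add: E_def power2_norm_eq_inner)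
qed

text \<open>If the limit returned to \<open>p\<close>, cutting off the initial excursion of \<open>us n\<close> to the sphere of
  radius \<open>\<rho>\<close> would save a fixed amount of action, contradicting minimality.\<close>

lemma minimizing_limit_no_return:
  assumes con: "\<And>n. connects U p q (B n) (us n) (vs n)" and B: "B \<longlonglongrightarrow> d" and BC: "\<And>n. B n \<le> C"
    and low: "\<And>B' u' v'. connects U p q B' u' v' \<Longrightarrow> d \<le> B'"
    and conv: "\<And>t. (\<lambda>n. us n t) \<longlonglongrightarrow> u t"
    and start: "\<And>n. norm (us n 0 - p) = \<rho>" "\<And>n t. t \<le> 0 \<Longrightarrow> norm (us n t - p) \<le> \<rho>" and \<rho>: "0 < \<rho>"
    and p: "p \<in> P" and iso: "\<And>x. x \<in> P \<Longrightarrow> x \<noteq> p \<Longrightarrow> \<rho> < dist x p"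
  shows "\<not> (u \<longlongrightarrow> p) at_top"
proof
  assume lim: "(u \<longlongrightarrow> p) at_top"
  have uv: "piecewise_path (us n) (vs n)" and J: "integral {a..b} (lagrangian U (us n) (vs n)) \<le> B n" for n a b
    using con[of n] by (auto simp: connects_def)
  have C0: "0 \<le> C" using J[of 0 0 0] BC[of 0] by simp
  have H: "(norm (us n t - us n s))\<^sup>2 \<le> 2 * C * (t - s)" if "s \<le> t" for n s t
    by (rule norm_diff_sq_le[OF uv that order_trans[OF J BC]])
  have "compact (cball p \<rho> - ball p (\<rho>/2))" by (intro compact_diff) auto
  moreover have "0 < U x" if "x \<in> cball p \<rho> - ball p (\<rho>/2)" for x
    using that iso[of x] \<rho> U_eq_0_iff[of x] U_nonneg[of x] by (force simp: dist_commute)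
  ultimately obtain \<mu> where \<mu>: "0 < \<mu>" "\<And>x. x \<in> cball p \<rho> - ball p (\<rho>/2) \<Longrightarrow> \<mu> \<le> U x"
    using compact_pos_lower_bound continuous_U by metis
  \<comment> \<open>Half the time in which the Hoelder estimate guarantees a displacement below
    \<open>\<rho>/2\<close>. Throughout \<open>{-\<delta>..0}\<close> the curve thus stays in the
    annulus where \<open>U\<close> is at least \<open>\<mu>\<close>.\<close>
  define \<delta> where "\<delta> = (\<rho>/2)\<^sup>2 / (2 * C + 1) / 2"
  have \<delta>: "0 < \<delta>" "\<delta> < (\<rho>/2)\<^sup>2 / (2 * C + 1)" using \<rho> C0 by (auto simp: \<delta>_def divide_simps)
  have gain: "\<mu> * \<delta> \<le> integral {-\<delta>..0} (lagrangian U (us n) (vs n))" for n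
  proof -
    have "\<mu> \<le> U (us n t)" if t: "t \<in> {-\<delta>..0}" for t
    proof (rule \<mu>(2))
      have "\<bar>t - 0\<bar> < (\<rho>/2)\<^sup>2 / (2 * C + 1)" using t \<delta> by auto
      then have "norm (us n t - us n 0) < \<rho>/2"
        using holder_half_uniform[of "us n" "2 * C" "\<rho>/2" t 0, OF H] C0 \<rho> by simp
      then have "\<rho>/2 < norm (us n t - p)"
        using start(1)[of n] norm_triangle_sub[of "us n 0 - p" "us n t - p"]
        by (simp add: norm_minus_commute)
      then show "us n t \<in> cball p \<rho> - ball p (\<rho>/2)"
        using start(2)[of t n] t by (auto simp: dist_norm norm_minus_commute)
    qed
    then have "integral {-\<delta>..0} (\<lambda>_. \<mu>) \<le> integral {-\<delta>..0} (\<lambda>t. U (us n t))"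
      using uv[of n] by (intro integral_le integrable_U integrable_const_ivl) (auto simp: piecewise_path_def)
    also have "\<dots> \<le> integral {-\<delta>..0} (lagrangian U (us n) (vs n))" by (rule integral_U_le[OF uv])
    finally show ?thesis using \<delta>(1) by (simp add: mult.commute)
  qed
  have "bounded (U ` cball p 1)"
    by (intro compact_imp_bounded compact_continuous_image continuous_U compact_cball)
  then obtain M where M: "\<And>x. x \<in> cball p 1 \<Longrightarrow> norm (U x) \<le> M" unfolding bounded_iff by (metis imageI)
  have M0: "0 \<le> M" using M[of p] order_trans[OF norm_ge_zero] by simp
  \<comment> \<open>Joining \<open>p\<close> to a point at distance below \<open>\<epsilon>\<close>
    in time \<open>\<epsilon>\<close> costs at most \<open>\<epsilon> * (1/2 + M)\<close>. This is
    at most half of the gain \<open>\<mu> * \<delta>\<close>, and the other half absorbs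
    \<open>B n - d\<close>. The bound 1 keeps the segment inside \<open>cball p 1\<close>.\<close>
  define \<epsilon> where "\<epsilon> = min 1 (\<mu> * \<delta> / 2 / (1/2 + M))"
  have \<epsilon>: "0 < \<epsilon>" "\<epsilon> \<le> 1" using \<mu> \<delta> M0 by (auto simp: \<epsilon>_def)
  have "\<epsilon> \<le> \<mu> * \<delta> / 2 / (1/2 + M)" by (simp add: \<epsilon>_def)
  then have \<epsilon>M: "\<epsilon> * (1/2 + M) \<le> \<mu> * \<delta> / 2" by (subst (asm) pos_le_divide_eq) (use M0 in auto)
  obtain t0 where "\<And>t. t0 \<le> t \<Longrightarrow> dist (u t) p < \<epsilon>"
    using tendstoD[OF lim \<epsilon>(1)] unfolding eventually_at_top_linorder by blast
  then obtain t1 where t1: "0 \<le> t1" "dist (u t1) p < \<epsilon>" by (meson max.cobounded1 max.cobounded2)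
  have "eventually (\<lambda>n. dist (us n t1) p < \<epsilon> \<and> B n < d + \<mu> * \<delta> / 2) sequentially"
  proof (rule eventually_conj)
    show "eventually (\<lambda>n. dist (us n t1) p < \<epsilon>) sequentially"
      using t1(2) by (intro order_tendstoD(2)[OF tendsto_dist[OF conv tendsto_const]])
    show "eventually (\<lambda>n. B n < d + \<mu> * \<delta> / 2) sequentially"
      using \<mu> \<delta> by (intro order_tendstoD(2)[OF B]) auto
  qed
  then obtain n where n: "norm (us n t1 - p) < \<epsilon>" "B n < d + \<mu> * \<delta> / 2"
    unfolding eventually_sequentially dist_norm by blast
  from con[of n] obtain T where T: "\<And>t. T \<le> t \<Longrightarrow> us n t = q" by (auto simp: connects_def)
  have tail: "integral {t1..b} (lagrangian U (us n) (vs n)) \<le> B n - \<mu> * \<delta>" for b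
  proof -
    define b' where "b' = max b t1"
    note i = integrable_lagrangian[OF uv[of n]]
    have "integral {t1..b} (lagrangian U (us n) (vs n)) \<le> integral {t1..b'} (lagrangian U (us n) (vs n))"
      by (rule integral_lagrangian_mono[OF uv]) (auto simp: b'_def)
    moreover have "integral {t1..b'} (lagrangian U (us n) (vs n)) \<le> integral {0..b'} (lagrangian U (us n) (vs n))"
      by (rule integral_lagrangian_mono[OF uv]) (use t1 in auto)
    moreover have "integral {-\<delta>..0} (lagrangian U (us n) (vs n)) + integral {0..b'} (lagrangian U (us n) (vs n))
        = integral {-\<delta>..b'} (lagrangian U (us n) (vs n))"
      using \<delta> t1 by (intro Henstock_Kurzweil_Integration.integral_combine i) (auto simp: b'_def)
    ultimately show ?thesis using gain[of n] J[where n=n and a="-\<delta>" and b=b'] by linarith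
  qed
  have seg: "U x \<le> M" if "x \<in> closed_segment p (us n t1)" for x
  proof -
    have "closed_segment p (us n t1) \<subseteq> cball p 1"
      using n(1) \<epsilon> by (intro closed_segment_subset) (auto simp: dist_norm norm_minus_commute)
    then show ?thesis using M[of x] that by auto
  qed
  obtain y w where "connects U p q (B n - \<mu> * \<delta> + (norm (us n t1 - p))\<^sup>2 / (2 * \<epsilon>) + \<epsilon> * M) y w"
    using connects_splice[OF uv T tail \<epsilon>(1) p seg] by blast
  then have "d \<le> B n - \<mu> * \<delta> + (norm (us n t1 - p))\<^sup>2 / (2 * \<epsilon>) + \<epsilon> * M" by (rule low)
  moreover have "(norm (us n t1 - p))\<^sup>2 / (2 * \<epsilon>) \<le> \<epsilon>\<^sup>2 / (2 * \<epsilon>)"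
    using n(1) \<epsilon> by (intro divide_right_mono power_mono) auto
  moreover have "\<epsilon>\<^sup>2 / (2 * \<epsilon>) = \<epsilon> / 2" using \<epsilon> by (simp add: power2_eq_square)
  ultimately show False using n(2) \<epsilon>M by (simp add: algebra_simps)
qed


text \<open>The infimum of the admissible bounds is the infimal action. Bounds are invariant under
  time shifts, so each nearly optimal curve can be shifted to its first exit, which exists because
  \<open>q\<close> lies outside the ball. This anchors the sequence in time and keeps the limit from
  being constantly \<open>p\<close>.\<close>

lemma minimizing_sequence:
  assumes p: "p \<in> P" and q: "q \<in> P" and ne: "p \<noteq> q"
    and \<rho>: "0 < \<rho>" and iso: "\<forall>x\<in>P - {p}. \<rho> < dist x p"
  shows "\<exists>(B :: nat \<Rightarrow> real) us vs d. (\<forall>n. connects U p q (B n) (us n) (vs n)) \<and> B \<longlonglongrightarrow> d \<and>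
    (\<forall>n. B n \<le> d + 1) \<and> 0 \<le> d \<and> (\<forall>B' u' v'. connects U p q B' u' v' \<longrightarrow> d \<le> B') \<and>
    (\<forall>n. norm (us n 0 - p) = \<rho>) \<and> (\<forall>n. \<forall>t\<le>0. norm (us n t - p) \<le> \<rho>)"
proof -
  define X where "X = {B. \<exists>u v. connects U p q B u v}"
  define d where "d = Inf X"
  have nonneg: "0 \<le> B" if "B \<in> X" for B
  proof -
    have "integral {0..0::real} (lagrangian U u v) \<le> B" if "connects U p q B u v" for u v
      using that unfolding connects_def by blast
    then show ?thesis using that by (auto simp: X_def)
  qed
  have "X \<noteq> {}" using connects_exists[OF p q] unfolding X_def by blast
  have bdd: "bdd_below X" by (rule bdd_belowI[OF nonneg])
  have low: "d \<le> B'" if "connects U p q B' u' v'" for B' u' v'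
    unfolding d_def using that by (intro cInf_lower bdd) (auto simp: X_def)
  have d0: "0 \<le> d" unfolding d_def using \<open>X \<noteq> {}\<close> nonneg by (intro cInf_greatest)
  have "\<exists>B u v. connects U p q B u v \<and> B < d + 1 / real (Suc n) \<and>
          norm (u 0 - p) = \<rho> \<and> (\<forall>t\<le>0. norm (u t - p) \<le> \<rho>)" for n
  proof -
    have "Inf X < d + 1 / real (Suc n)" by (simp add: d_def)
    then obtain B u v where B: "B < d + 1 / real (Suc n)" and con: "connects U p q B u v"
      using cInf_lessD[OF \<open>X \<noteq> {}\<close>] unfolding X_def by blast
    from con have cu: "continuous_on UNIV u"
      and "\<exists>T. (\<forall>t\<le>-T. u t = p) \<and> (\<forall>t\<ge>T. u t = q)" by (auto simp: connects_def piecewise_path_def)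
    then obtain T where T: "\<And>t. t \<le> -T \<Longrightarrow> u t = p" "u T = q" by blast
    have "\<rho> \<le> norm (u T - p)" using iso[rule_format, of q] q ne T by (simp add: dist_norm)
    then obtain s where s: "norm (u s - p) = \<rho>" "\<And>t. t \<le> s \<Longrightarrow> norm (u t - p) \<le> \<rho>"
      using first_exit_time[OF cu less_imp_le[OF \<rho>] T(1)] by blast
    have "connects U p q B (\<lambda>t. u (t + s)) (\<lambda>t. v (t + s))" by (rule connects_shift[OF con])
    then show ?thesis using B s by (intro exI[of _ B] exI[of _ "\<lambda>t. u (t + s)"] exI[of _ "\<lambda>t. v (t + s)"]) auto
  qed
  then obtain B us vs where con: "\<And>n. connects U p q (B n) (us n) (vs n)"
    and B: "\<And>n. B n < d + 1 / real (Suc n)"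
    and us: "\<And>n. norm (us n 0 - p) = \<rho>" "\<And>n t. t \<le> 0 \<Longrightarrow> norm (us n t - p) \<le> \<rho>"
    by metis
  have lim: "B \<longlonglongrightarrow> d"
  proof (rule tendsto_sandwich[of "\<lambda>_. d" B _ "\<lambda>n. d + 1 / real (Suc n)"])
    show "(\<lambda>n. d + 1 / real (Suc n)) \<longlonglongrightarrow> d"
      using tendsto_add[OF tendsto_const[of d] LIMSEQ_inverse_real_of_nat] by (simp add: inverse_eq_divide)
  qed (use low[OF con] B less_imp_le in \<open>auto intro!: always_eventually\<close>)
  have le: "B n \<le> d + 1" for n
  proof -
    have "1 / real (Suc n) \<le> 1" by simp
    then show ?thesis using B[of n] by linarith
  qed
  show ?thesis
    using con lim le d0 low us
    by (intro exI[of _ B] exI[of _ us] exI[of _ vs] exI[of _ d] conjI allI impI)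
qed

theorem heteroclinic_exists:
  assumes p: "p \<in> P" and q0: "q0 \<in> P" "q0 \<noteq> p"
  obtains q u v where "q \<in> P" "q \<noteq> p"
    "\<And>t. (u has_vector_derivative v t) (at t)"
    "\<And>t. (v has_vector_derivative G (u t)) (at t)"
    "\<And>t. 1/2 * (norm (v t))\<^sup>2 - U (u t) = 0"
    "(u \<longlongrightarrow> p) at_bot" "(u \<longlongrightarrow> q) at_top"
proof -
  obtain \<rho>0 where \<rho>0: "0 < \<rho>0" "\<And>x. x \<in> P \<Longrightarrow> x \<noteq> p \<Longrightarrow> \<rho>0 \<le> dist p x"
    using finite_set_avoid[OF finite_P] by metis
  define \<rho> where "\<rho> = \<rho>0 / 2"
  have \<rho>: "0 < \<rho>" using \<rho>0 by (simp add: \<rho>_def)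
  have iso: "\<rho> < dist x p" if "x \<in> P" "x \<noteq> p" for x
    using \<rho>0(1) \<rho>0(2)[OF that] by (simp add: \<rho>_def dist_commute)
  have iso': "\<forall>x\<in>P - {p}. \<rho> < dist x p" using iso by blast
  from minimizing_sequence[OF p q0(1) not_sym[OF q0(2)] \<rho> iso'] obtain B us vs d
    where "\<forall>n::nat. connects U p q0 (B n) (us n) (vs n)" and B: "B \<longlonglongrightarrow> d"
      and "\<forall>n. B n \<le> d + 1" and d0: "0 \<le> d"
      and "\<forall>B' u' v'. connects U p q0 B' u' v' \<longrightarrow> d \<le> B'"
      and "\<forall>n. norm (us n 0 - p) = \<rho>" "\<forall>n. \<forall>t\<le>0. norm (us n t - p) \<le> \<rho>"
    by (elim exE conjE)
  then have con: "\<And>n. connects U p q0 (B n) (us n) (vs n)" and BC: "\<And>n::nat. B n \<le> d + 1"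
    and low: "\<And>B' u' v'. connects U p q0 B' u' v' \<Longrightarrow> d \<le> B'"
    and start: "\<And>n. norm (us n 0 - p) = \<rho>" "\<And>n t. t \<le> 0 \<Longrightarrow> norm (us n t - p) \<le> \<rho>"
    by blast+
  have uv: "piecewise_path (us n) (vs n)"
    and J: "integral {a..b} (lagrangian U (us n) (vs n)) \<le> d + 1" for n a b
    using con[of n] order_trans[OF _ BC[of n]] unfolding connects_def by blast+
  have "connects U p q0 (d + 1) (us n) (vs n)" for n
    using con[of n] J[where n = n] unfolding connects_def by blast
  then obtain R where R: "\<And>n t. norm (us n t) \<le> R" using connects_bounded by metis
  define L where "L = 2 * (d + 1)"
  have L: "0 \<le> L" using d0 by (simp add: L_def)
  have Hn: "(norm (us n t - us n s))\<^sup>2 \<le> L * (t - s)" if "s \<le> t" for n s t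
    unfolding L_def by (rule norm_diff_sq_le[OF uv that J])
  obtain k u where k: "strict_mono (k :: nat \<Rightarrow> nat)" and conv: "\<And>t. (\<lambda>n. us (k n) t) \<longlonglongrightarrow> u t"
    using equi_holder_convergent_subsequence[of us R L, OF R Hn L] by blast
  have conk: "connects U p q0 (B (k n)) (us (k n)) (vs (k n))" for n by (rule con)
  have Bk: "(\<lambda>n. B (k n)) \<longlonglongrightarrow> d" using LIMSEQ_subseq_LIMSEQ[OF B k] by (simp add: o_def)
  have uR: "norm (u t) \<le> R" for t
    by (rule LIMSEQ_le_const2[OF tendsto_norm[OF conv]]) (use R in auto)
  have H: "(norm (u t - u s))\<^sup>2 \<le> L * (t - s)" if "s \<le> t" for s t
    by (rule LIMSEQ_le_const2[OF tendsto_power[OF tendsto_norm[OF tendsto_diff[OF conv conv]]]])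
      (use Hn that in auto)
  have cu: "continuous_on UNIV u"
    unfolding continuous_on_iff
  proof (intro ballI allI impI)
    fix t e :: real assume e: "0 < e"
    show "\<exists>\<delta>>0. \<forall>s\<in>UNIV. dist s t < \<delta> \<longrightarrow> dist (u s) (u t) < e"
      using holder_half_uniform[OF H L e] e L
      by (intro exI[of _ "e\<^sup>2 / (L + 1)"]) (auto simp: dist_norm)
  qed
  have sol: "\<exists>w. \<forall>t\<in>{-N..N}. (u has_vector_derivative w t) (at t within {-N..N}) \<and>
      (w has_vector_derivative G (u t)) (at t within {-N..N})" if "0 < N" for N
    by (rule minimizing_limit_solves[of p q0 "\<lambda>n. B (k n)" "\<lambda>n. us (k n)" "\<lambda>n. vs (k n)" d R u])
      (use conk Bk low R conv cu that in auto)
  \<comment> \<open>The intervals \<open>{-N..N}\<close> come with separately chosen velocities; the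
    derivative of \<open>u\<close> itself agrees with each of them in the interior.\<close>
  define v where "v t = vector_derivative u (at t)" for t
  have uv': "(u has_vector_derivative v t) (at t) \<and> (v has_vector_derivative G (u t)) (at t)" for t
  proof -
    define N where "N = \<bar>t\<bar> + 1"
    have "0 < N" by (simp add: N_def)
    from sol[OF this] obtain w where "\<forall>s\<in>{-N..N}. (u has_vector_derivative w s) (at s within {-N..N}) \<and>
      (w has_vector_derivative G (u s)) (at s within {-N..N})" ..
    then have w: "\<And>s. s \<in> {-N..N} \<Longrightarrow> (u has_vector_derivative w s) (at s within {-N..N})"
      "\<And>s. s \<in> {-N..N} \<Longrightarrow> (w has_vector_derivative G (u s)) (at s within {-N..N})"
      by blast+
    have at: "at s within {-N..N} = at s" if "s \<in> {-N<..<N}" for s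
      using that by (intro at_within_interior) auto
    have us: "(u has_vector_derivative w s) (at s)" if "s \<in> {-N<..<N}" for s
      using w(1)[of s] at[OF that] that by auto
    then have vw: "v s = w s" if "s \<in> {-N<..<N}" for s
      using vector_derivative_at that unfolding v_def by blast
    have t: "t \<in> {-N<..<N}" by (auto simp: N_def)
    have "(w has_vector_derivative G (u t)) (at t)" using w(2)[of t] at[OF t] t by auto
    then have "(v has_vector_derivative G (u t)) (at t)"
      by (rule has_vector_derivative_transform_within_open[of _ _ _ "{-N<..<N}"])
        (use t vw in auto)
    then show ?thesis using us[OF t] vw[OF t] by simp
  qed
  \<comment> \<open>The potential part of the action bound passes to the limit by dominated
    convergence; convergence at both ends rests on it.\<close>
  have IU: "integral {a..b} (\<lambda>t. U (u t)) \<le> d + 1" for a b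
  proof (rule LIMSEQ_le_const2)
    have "bounded (U ` cball 0 R)"
      by (intro compact_imp_bounded compact_continuous_image continuous_U compact_cball)
    then obtain M where M: "\<And>x. norm x \<le> R \<Longrightarrow> norm (U x) \<le> M"
      unfolding bounded_iff by (metis imageI mem_cball_0)
    have "isCont U x" for x using continuous_U[of UNIV] by (simp add: continuous_on_eq_continuous_at)
    then show "(\<lambda>n. integral {a..b} (\<lambda>t. U (us (k n) t))) \<longlonglongrightarrow> integral {a..b} (\<lambda>t. U (u t))"
      using uv R M
      by (intro dominated_convergence(2)[where h = "\<lambda>_. M"] integrable_U integrable_const_ivl
          isCont_tendsto_compose[of _ U] conv) (auto simp: piecewise_path_def)
    show "\<exists>N. \<forall>n\<ge>N. integral {a..b} (\<lambda>t. U (us (k n) t)) \<le> d + 1"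
      using order_trans[OF integral_U_le[OF uv] J] by blast
  qed
  obtain q where q: "q \<in> P" "(u \<longlongrightarrow> q) at_top"
    using tendsto_well[of u R L "d + 1", OF cu uR H L IU] by blast
  have "\<exists>q'\<in>P. ((\<lambda>t. u (- t)) \<longlongrightarrow> q') at_top"
  proof -
    have 1: "integral {0..b} (\<lambda>t. U (u (- t))) \<le> d + 1" for b
      using IU[of "-b" 0] Henstock_Kurzweil_Integration.integral_reflect_real[of "0::real" "-b" "\<lambda>t. U (u t)"] by simp
    have 2: "(norm (u (- t) - u (- s)))\<^sup>2 \<le> L * (t - s)" if "s \<le> t" for s t
      using H[of "-t" "-s"] that by (simp add: norm_minus_commute)
    have 3: "continuous_on UNIV (\<lambda>t. u (- t))"
      by (intro continuous_on_compose2[OF cu] continuous_intros) auto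
    show ?thesis using tendsto_well[of "\<lambda>t. u (- t)" R L "d + 1", OF 3 uR 2 L 1] by blast
  qed
  then obtain q' where q': "q' \<in> P" "(u \<longlongrightarrow> q') at_bot"
    unfolding filterlim_at_bot_mirror by blast
  \<comment> \<open>Inherited from the first exit at time 0. It places the limit at minus infinity
    in the closed ball of radius \<open>\<rho>\<close> around \<open>p\<close>, which contains no
    other well.\<close>
  have "norm (u t - p) \<le> \<rho>" if "t \<le> 0" for t
    by (rule LIMSEQ_le_const2[OF tendsto_norm[OF tendsto_diff[OF conv tendsto_const]]])
      (use start(2) that in auto)
  then have "eventually (\<lambda>t. dist (u t) p \<le> \<rho>) at_bot"
    unfolding eventually_at_bot_linorder dist_norm by blast
  then have "dist q' p \<le> \<rho>"
    by (rule tendsto_upperbound[OF tendsto_dist[OF q'(2) tendsto_const]]) simp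
  then have "q' = p" using iso[OF q'(1)] by force
  moreover have "q \<noteq> p"
  proof -
    have "\<not> (u \<longlongrightarrow> p) at_top"
      by (rule minimizing_limit_no_return[of p q0 "\<lambda>n. B (k n)" "\<lambda>n. us (k n)" "\<lambda>n. vs (k n)" d "d + 1" u \<rho>])
        (use conk Bk BC low conv start \<rho> p iso in auto)
    then show ?thesis using q(2) by blast
  qed
  moreover have "1/2 * (norm (v t))\<^sup>2 - U (u t) = 0" for t
    using zero_energy[OF _ _ q, of v] uv' by blast
  ultimately show ?thesis using that[of q u v] uv' q q' by blast
qed

end

section \<open>Confinement by radial lower bounds\<close>

lemma GDERIV_unique:
  assumes "GDERIV f x :> D" "GDERIV f x :> E"
  shows "D = E"
proof -
  have "(\<lambda>h. h \<bullet> D) = (\<lambda>h. h \<bullet> E)"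
    using assms unfolding gderiv_def by (rule has_derivative_unique)
  then show ?thesis by (metis vector_eq_ldot)
qed

lemma gradient_eqI: "GDERIV f x :> D \<Longrightarrow> gradient f x = D"
  unfolding gradient_def by (rule the_equality) (auto dest: GDERIV_unique)

lemma class_C2_gradient:
  fixes U :: "'a::euclidean_space \<Rightarrow> real"
  assumes "class_C2 U"
  obtains G where "\<And>x. GDERIV U x :> G x" "continuous_on UNIV G"
proof -
  obtain f' :: "'a \<Rightarrow> 'a \<Rightarrow>\<^sub>L real" and f'' where f': "\<And>x. (U has_derivative blinfun_apply (f' x)) (at x)"
    and f'': "\<And>x. (f' has_derivative blinfun_apply (f'' x)) (at x)"
    using assms unfolding class_C2_def by blast
  define G where "G x = (\<Sum>i\<in>Basis. blinfun_apply (f' x) i *\<^sub>R i)" for x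
  have "blinfun_apply (f' x) h = h \<bullet> G x" for x h
  proof -
    have "blinfun_apply (f' x) h = blinfun_apply (f' x) (\<Sum>i\<in>Basis. (h \<bullet> i) *\<^sub>R i)"
      by (simp add: euclidean_representation)
    also have "\<dots> = h \<bullet> G x"
      by (simp add: blinfun.sum_right blinfun.scaleR_right G_def inner_sum_right mult.commute)
    finally show ?thesis .
  qed
  then have "blinfun_apply (f' x) = (\<lambda>h. h \<bullet> G x)" for x by blast
  then have "GDERIV U x :> G x" for x using f'[of x] by (simp only: gderiv_def)
  moreover have "continuous_on UNIV f'"
    by (intro continuous_at_imp_continuous_on ballI has_derivative_continuous[OF f''])
  then have "continuous_on UNIV G" unfolding G_def by (intro continuous_intros)
  ultimately show ?thesis by (rule that)
qed

text \<open>At a frontier point \<open>U\<close> is nonnegative by continuity. Were it positive,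
  adjoining the point to the component would give a larger connected subset of the positivity set,
  against maximality.\<close>

lemma component_pos_set:
  fixes U :: "'a::real_normed_vector \<Rightarrow> real"
  assumes cU: "continuous_on UNIV U" and \<Omega>: "\<Omega> \<in> components {x. U x > 0}"
  shows "connected \<Omega>" "\<Omega> \<subseteq> {x. U x > 0}" "\<Omega> \<inter> frontier \<Omega> = {}"
    "\<And>p. p \<in> frontier \<Omega> \<Longrightarrow> U p = 0"
proof -
  have op: "open {x. U x > 0}" by (intro open_Collect_less continuous_intros cU)
  have o: "open \<Omega>" using open_components[OF op \<Omega>] .
  show c: "connected \<Omega>" "\<Omega> \<subseteq> {x. U x > 0}" using \<Omega> in_components_connected in_components_subset by blast+
  show "\<Omega> \<inter> frontier \<Omega> = {}" using o frontier_disjoint_eq by blast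
  fix p assume p: "p \<in> frontier \<Omega>"
  have "closed {x. 0 \<le> U x}" by (intro closed_Collect_le continuous_intros cU)
  moreover have "\<Omega> \<subseteq> {x. 0 \<le> U x}" using c(2) by force
  ultimately have "closure \<Omega> \<subseteq> {x. 0 \<le> U x}" by (intro closure_minimal)
  moreover have pc: "p \<in> closure \<Omega>" using p by (simp add: frontier_def)
  ultimately have "0 \<le> U p" by blast
  moreover have "\<not> 0 < U p"
  proof
    assume "0 < U p"
    then have "insert p \<Omega> \<subseteq> {x. U x > 0}" using c(2) by blast
    moreover have "connected (insert p \<Omega>)"
      by (rule connected_intermediate_closure[OF c(1)]) (use pc closure_subset in auto)
    moreover have "\<Omega> \<inter> insert p \<Omega> \<noteq> {}" using in_components_nonempty[OF \<Omega>] by blast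
    ultimately have "insert p \<Omega> \<subseteq> \<Omega>" using components_maximal[OF \<Omega>] by blast
    then show False using p \<open>\<Omega> \<inter> frontier \<Omega> = {}\<close> by blast
  qed
  ultimately show "U p = 0" by simp
qed

text \<open>In dimension at least two a finite set does not disconnect the space, and a connected
  set that misses the frontier of \<open>\<Omega>\<close> cannot meet both \<open>\<Omega>\<close>
  and its complement.\<close>

lemma complement_of_finite_frontier:
  fixes \<Omega> :: "'a::euclidean_space set"
  assumes "2 \<le> DIM('a)" "finite (frontier \<Omega>)" "\<Omega> \<noteq> {}" "\<Omega> \<inter> frontier \<Omega> = {}"
  shows "\<Omega> = - frontier \<Omega>"
proof -
  have "connected (- frontier \<Omega>)"
    using assms(1,2) path_connected_complement_countable path_connected_imp_connected countable_finite by blast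
  then have "- frontier \<Omega> - \<Omega> = {}"
    using connected_Int_frontier[of "- frontier \<Omega>" \<Omega>] assms(3,4) by blast
  then show ?thesis using assms(4) by blast
qed

text \<open>Two functions on \<open>S\<close> that differ by at most \<open>e\<close> have minima
  that differ by at most \<open>e\<close>; uniform continuity near \<open>r\<close> supplies this
  closeness. It serves to make the minimum of \<open>sqrt U\<close> over spheres continuous in the
  radius.\<close>

lemma continuous_on_INF_compact:
  fixes g :: "'a::heine_borel \<Rightarrow> 'b::metric_space \<Rightarrow> real"
  assumes S: "compact S" "S \<noteq> {}" and g: "continuous_on (UNIV \<times> S) (\<lambda>(r, s). g r s)"
  shows "continuous_on UNIV (\<lambda>r. INF s\<in>S. g r s)"
proof -
  have cS: "continuous_on S (g r)" for r
    by (rule continuous_on_compose2[OF g, of S "\<lambda>s. (r, s)", simplified])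
      (auto intro!: continuous_intros)
  have att: "\<exists>s\<in>S. (INF s\<in>S. g r s) = g r s \<and> (\<forall>t\<in>S. g r s \<le> g r t)" for r
  proof -
    obtain s where s: "s \<in> S" "\<And>t. t \<in> S \<Longrightarrow> g r s \<le> g r t"
      using continuous_attains_inf[OF S cS] by blast
    then have "(INF s\<in>S. g r s) = g r s"
      by (intro cInf_eq_minimum) auto
    then show ?thesis using s by blast
  qed
  have half: "(INF s\<in>S. g r s) - (INF s\<in>S. g r' s) \<le> e" if "\<And>s. s \<in> S \<Longrightarrow> g r s \<le> g r' s + e" for r r' e
  proof -
    obtain s where s: "s \<in> S" "(INF s\<in>S. g r' s) = g r' s" using att[of r'] by blast
    obtain s' where s': "(INF s\<in>S. g r s) = g r s'" "\<And>t. t \<in> S \<Longrightarrow> g r s' \<le> g r t" using att[of r] by blast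
    show ?thesis using s s' that[OF s(1)] by fastforce
  qed
  show ?thesis unfolding continuous_on_iff
  proof (intro ballI allI impI)
    fix r :: 'a and e :: real assume e: "0 < e"
    have "uniformly_continuous_on (cball r 1 \<times> S) (\<lambda>(r, s). g r s)"
      by (intro compact_uniformly_continuous compact_Times compact_cball S(1)
          continuous_on_subset[OF g]) auto
    then obtain d where d: "0 < d" "\<And>x y. x \<in> cball r 1 \<times> S \<Longrightarrow> y \<in> cball r 1 \<times> S \<Longrightarrow> dist x y < d \<Longrightarrow>
        dist ((\<lambda>(r, s). g r s) x) ((\<lambda>(r, s). g r s) y) < e / 2"
      unfolding uniformly_continuous_on_def using e by (metis half_gt_zero)
    have "dist (INF s\<in>S. g r' s) (INF s\<in>S. g r s) < e" if r': "dist r' r < min d 1" for r'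
    proof -
      have near: "g r s \<le> g r' s + e / 2" "g r' s \<le> g r s + e / 2" if "s \<in> S" for s
      proof -
        have "dist (g r s) (g r' s) < e / 2"
          using d(2)[of "(r, s)" "(r', s)"] that r' by (simp add: dist_commute dist_Pair_Pair)
        then show "g r s \<le> g r' s + e / 2" "g r' s \<le> g r s + e / 2"
          unfolding dist_real_def by linarith+
      qed
      have "(INF s\<in>S. g r s) - (INF s\<in>S. g r' s) \<le> e / 2"
        by (rule half) (rule near)
      moreover have "(INF s\<in>S. g r' s) - (INF s\<in>S. g r s) \<le> e / 2"
        by (rule half) (rule near)
      ultimately show ?thesis using e by (simp add: dist_real_def)
    qed
    then show "\<exists>d>0. \<forall>r'\<in>UNIV. dist r' r < d \<longrightarrow> dist (INF s\<in>S. g r' s) (INF s\<in>S. g r s) < e"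
      using d(1) by (intro exI[of _ "min d 1"]) auto
  qed
qed

text \<open>Off the origin the norm has a unit gradient, so the slope bound is one on
  \<open>m\<close>. At the origin, where the norm is not differentiable, \<open>m 0 = 0\<close>
  makes the composition flat. Sublevel sets are bounded because \<open>M\<close> is nondecreasing
  and unbounded.\<close>

lemma radial_function:
  fixes U :: "'a::euclidean_space \<Rightarrow> real"
  assumes M: "\<And>r. 0 \<le> r \<Longrightarrow> (M has_real_derivative m r) (at r)"
    and m: "\<And>r. 0 \<le> m r" "m 0 = 0" and mU: "\<And>x. (m (norm x))\<^sup>2 \<le> 2 * U x"
    and unb: "\<And>c. \<exists>r\<ge>0. c < M r"
  shows "GDERIV (\<lambda>x. M (norm x)) x :> m (norm x) *\<^sub>R sgn x"
    "(norm (m (norm x) *\<^sub>R sgn x))\<^sup>2 \<le> 2 * U x"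
    "bounded {x::'a. M (norm x) \<le> c}"
proof -
  show "GDERIV (\<lambda>x. M (norm x)) x :> m (norm x) *\<^sub>R sgn x"
  proof (cases "x = 0")
    case False
    then show ?thesis using GDERIV_DERIV_compose[OF GDERIV_norm M] by simp
  next
    case True
    have "(*) (m 0) = (\<lambda>h. 0)" using m(2) by (simp add: fun_eq_iff)
    then have "(M has_derivative (\<lambda>h. 0)) (at 0)"
      using M[of 0] unfolding has_field_derivative_def by simp
    then have M0: "\<exists>d>0. \<forall>y. norm y < d \<longrightarrow> norm (M y - M 0) \<le> e * norm y" if "0 < e" for e
      using that unfolding has_derivative_at_alt by simp
    have "((\<lambda>x. M (norm x)) has_derivative (\<lambda>h. 0)) (at (0::'a))"
      unfolding has_derivative_at_alt
    proof (intro conjI allI impI)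
      fix e :: real assume "0 < e"
      then obtain d where d: "0 < d" "\<And>y. norm y < d \<Longrightarrow> norm (M y - M 0) \<le> e * norm y" using M0 by blast
      have "norm (M (norm y) - M 0) \<le> e * norm y" if "norm y < d" for y :: 'a
        using d(2)[of "norm y"] that by simp
      then show "\<exists>d>0. \<forall>y::'a. norm (y - 0) < d \<longrightarrow>
          norm (M (norm y) - M (norm (0::'a)) - 0) \<le> e * norm (y - 0)"
        using d(1) by auto
    qed simp
    then show ?thesis using True m(2) by (simp add: gderiv_def)
  qed
  have "norm (m (norm x) *\<^sub>R sgn x) \<le> m (norm x)"
    using m(1)[of "norm x"] m(2) by (simp add: norm_sgn)
  then have "(norm (m (norm x) *\<^sub>R sgn x))\<^sup>2 \<le> (m (norm x))\<^sup>2"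
    by (intro power_mono) auto
  then show "(norm (m (norm x) *\<^sub>R sgn x))\<^sup>2 \<le> 2 * U x" using mU order_trans by blast
  obtain r where r: "0 \<le> r" "c < M r" using unb by blast
  have "norm x \<le> r" if "M (norm x) \<le> c" for x :: 'a
  proof (rule ccontr)
    assume "\<not> norm x \<le> r"
    then have "M r \<le> M (norm x)"
      using r(1)
      by (intro DERIV_nonneg_imp_nondecreasing[of r _ M]) (auto intro!: exI[of _ "m x" for x] M m(1))
    then show False using that r(2) by simp
  qed
  then show "bounded {x::'a. M (norm x) \<le> c}" by (auto simp: bounded_iff)
qed

text \<open>A bounded \<open>M\<close> would converge, being monotone, and the fundamental theorem
  would make the integral of \<open>m / \<kappa>\<close> finite; this function dominates
  \<open>\<sigma>\<close> off the null set \<open>N\<close>. The comparison takes place in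
  \<open>lebesgue\<close>, after which the Borel function \<open>m\<close> is integrated in
  \<open>lborel\<close>.\<close>

lemma antiderivative_unbounded:
  fixes m M :: "real \<Rightarrow> real"
  assumes M: "\<And>r. 0 \<le> r \<Longrightarrow> (M has_real_derivative m r) (at r)"
    and m: "continuous_on UNIV m" "\<And>r. 0 \<le> m r"
    and r0: "0 \<le> r0" and \<kappa>: "0 < \<kappa>" and N: "finite N"
    and \<sigma>: "\<And>r. r0 \<le> r \<Longrightarrow> r \<notin> N \<Longrightarrow> \<kappa> * \<sigma> r \<le> m r"
    and int: "(\<integral>\<^sup>+ r. ennreal (\<sigma> r) \<partial>lebesgue_on {r0..}) = \<infinity>"
  shows "\<exists>r\<ge>0. c < M r"
proof (rule ccontr)
  assume "\<not> ?thesis"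
  then have Mc: "M r \<le> c" if "0 \<le> r" for r using that by force
  have mono: "M r \<le> M s" if "0 \<le> r" "r \<le> s" for r s
    using that
    by (intro DERIV_nonneg_imp_nondecreasing[of r s M]) (auto intro!: exI[of _ "m x" for x] M m(2))
  define T where "T = Sup (M ` {0..})"
  have bdd: "bdd_above (M ` {0..})" using Mc by (auto simp: bdd_above_def)
  have "(M \<longlongrightarrow> T) at_top"
  proof (rule order_tendstoI)
    fix l assume "l < T"
    then obtain r where r: "0 \<le> r" "l < M r" unfolding T_def using less_cSup_iff[OF _ bdd] by auto
    show "eventually (\<lambda>t. l < M t) at_top"
      using eventually_ge_at_top[of r] by eventually_elim (use mono r in fastforce)
  next
    fix l assume l: "T < l"
    show "eventually (\<lambda>t. M t < l) at_top"
      using eventually_ge_at_top[of 0]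
    proof eventually_elim
      case (elim t)
      then have "M t \<le> T" unfolding T_def by (intro cSup_upper bdd) auto
      then show ?case using l by simp
    qed
  qed
  then have "((\<lambda>t. M t / \<kappa>) \<longlongrightarrow> T / \<kappa>) at_top" by (intro tendsto_intros) (use \<kappa> in auto)
  then have fin: "(\<integral>\<^sup>+x. ennreal (m x / \<kappa>) * indicator {r0..} x \<partial>lborel) = ennreal (T / \<kappa> - M r0 / \<kappa>)"
  proof (rule nn_integral_FTC_atLeast[rotated 3])
    show "(\<lambda>x. m x / \<kappa>) \<in> borel_measurable borel"
      by (intro borel_measurable_continuous_onI continuous_intros m) (use \<kappa> in auto)
    show "((\<lambda>t. M t / \<kappa>) has_real_derivative m x / \<kappa>) (at x)" if "r0 \<le> x" for x
      using M[of x] r0 that by (intro DERIV_cdivide) auto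
  qed (use m \<kappa> in auto)
  have "(\<integral>\<^sup>+ r. ennreal (\<sigma> r) \<partial>lebesgue_on {r0..}) = (\<integral>\<^sup>+ r. ennreal (\<sigma> r) * indicator {r0..} r \<partial>lebesgue)"
    by (rule nn_integral_restrict_space) auto
  also have "\<dots> \<le> (\<integral>\<^sup>+ r. ennreal (m r / \<kappa>) * indicator {r0..} r \<partial>lebesgue)"
  proof (rule nn_integral_mono_AE)
    have "AE r in lebesgue. r \<notin> N"
      by (intro AE_not_in null_sets_completionI finite_imp_null_set_lborel N)
    then show "AE r in lebesgue. ennreal (\<sigma> r) * indicator {r0..} r \<le> ennreal (m r / \<kappa>) * indicator {r0..} r"
    proof eventually_elim
      case (elim r)
      then show ?case
        using \<sigma>[of r] \<kappa> by (auto simp: indicator_def field_simps intro!: ennreal_leI)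
    qed
  qed
  also have "\<dots> = ennreal (T / \<kappa> - M r0 / \<kappa>)" using fin by (simp add: nn_integral_completion)
  finally show False using int by (simp add: top_unique)
qed

text \<open>\<open>\<Phi>\<close> is a radial primitive of the spherical minimum of
  \<open>sqrt U\<close>, damped near the origin. The bound by \<open>\<sigma>\<close> says nothing
  at the wells, but only finitely many spheres meet \<open>P\<close>.\<close>

lemma multiwell_of_radial_bound:
  fixes U :: "'a::euclidean_space \<Rightarrow> real"
  assumes G: "\<And>x. GDERIV U x :> G x" "continuous_on UNIV G"
    and U: "\<And>x. 0 \<le> U x" "\<And>x. U x = 0 \<longleftrightarrow> x \<in> P" and P: "finite P"
    and r0: "0 < r0" and \<sigma>U: "\<And>x. x \<notin> P \<Longrightarrow> r0 \<le> norm x \<Longrightarrow> \<sigma> (norm x) \<le> sqrt (U x)"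
    and int: "(\<integral>\<^sup>+ r. ennreal (\<sigma> r) \<partial>lebesgue_on {r0..}) = \<infinity>"
  obtains \<Phi> \<Psi> where "multiwell U G \<Phi> \<Psi> P"
proof -
  have cU: "continuous_on S U" for S using GDERIV_imp_continuous_on G(1) .
  define I where "I r = (INF s\<in>sphere (0::'a) 1. sqrt (U (r *\<^sub>R s)))" for r
  have bdd: "bdd_below ((\<lambda>s. sqrt (U (r *\<^sub>R s))) ` sphere 0 1)" for r
    using U(1) by (auto intro!: bdd_belowI[of _ 0])
  have I0: "0 \<le> I r" for r
    unfolding I_def using U(1) by (intro cINF_greatest) auto
  have IU: "I r \<le> sqrt (U (r *\<^sub>R s))" if "norm s = 1" for r s
    unfolding I_def using that by (intro cINF_lower bdd) auto
  have cI: "continuous_on UNIV I"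
    unfolding I_def
  proof (rule continuous_on_INF_compact)
    show "continuous_on (UNIV \<times> sphere 0 1) (\<lambda>(r, s). sqrt (U (r *\<^sub>R (s::'a))))"
      unfolding split_beta
      by (intro continuous_intros continuous_on_compose2[OF cU[of UNIV]]) auto
  qed auto
  \<comment> \<open>The cutoff vanishes at 0, as differentiability at the origin demands, never
    exceeds 1, so that the slope bound persists, and is at least \<open>min 1 r0\<close> for
    \<open>r \<ge> r0\<close>, which keeps the integral infinite.\<close>
  define m where "m r = min 1 (max 0 r) * I r" for r
  have cm: "continuous_on UNIV m" unfolding m_def by (intro continuous_intros cI)
  have m0: "0 \<le> m r" for r using I0[of r] by (simp add: m_def)
  have mI: "m r \<le> I r" for r
    unfolding m_def using mult_right_mono[of "min 1 (max 0 r)" 1 "I r"] I0[of r] by simp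
  \<comment> \<open>starting at \<open>-1\<close> makes \<open>M\<close> differentiable at \<open>0\<close>\<close>
  define M where "M r = integral {-1..r} m" for r
  have dM: "(M has_real_derivative m r) (at r)" if "0 \<le> r" for r
  proof -
    have "(M has_real_derivative m r) (at r within {-1..r + 1})"
      unfolding M_def using that
      by (intro integral_has_real_derivative continuous_on_subset[OF cm]) auto
    moreover have "at r within {-1..r + 1} = at r"
      using that by (intro at_within_interior) auto
    ultimately show ?thesis by simp
  qed
  have mU: "(m (norm x))\<^sup>2 \<le> 2 * U x" for x
  proof (cases "x = 0")
    case True
    then show ?thesis using U(1) by (simp add: m_def)
  next
    case False
    then have "I (norm x) \<le> sqrt (U x)" using IU[of "sgn x" "norm x"] by (simp add: norm_sgn sgn_div_norm)
    then have "m (norm x) \<le> sqrt (U x)" using mI order_trans by blast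
    then have "(m (norm x))\<^sup>2 \<le> (sqrt (U x))\<^sup>2" using m0 by (intro power_mono)
    then show ?thesis using U(1)[of x] by simp
  qed
  have \<sigma>m: "min 1 r0 * \<sigma> r \<le> m r" if r: "r0 \<le> r" "r \<notin> norm ` P" for r
  proof -
    have "\<sigma> r \<le> I r"
      unfolding I_def
    proof (rule cINF_greatest)
      fix s :: 'a assume s: "s \<in> sphere 0 1"
      then have n: "norm (r *\<^sub>R s) = r" using r r0 by simp
      then have "r *\<^sub>R s \<notin> P" using r(2) by force
      then show "\<sigma> r \<le> sqrt (U (r *\<^sub>R s))" using \<sigma>U[of "r *\<^sub>R s"] n r by simp
    qed simp
    then have "min 1 r0 * \<sigma> r \<le> min 1 r0 * I r" using r0 by (intro mult_left_mono) auto
    also have "\<dots> \<le> m r" unfolding m_def using r r0 I0 by (intro mult_right_mono) auto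
    finally show ?thesis .
  qed
  have unb: "\<exists>r\<ge>0. c < M r" for c
    by (rule antiderivative_unbounded[OF dM cm m0 _ _ _ \<sigma>m int]) (use r0 P in auto)
  note rad = radial_function[OF dM m0 _ mU unb]
  have "multiwell U G (\<lambda>x. M (norm x)) (\<lambda>x. m (norm x) *\<^sub>R sgn x) P"
    by unfold_locales (use G U P rad in \<open>auto simp: m_def\<close>)
  then show ?thesis by (rule that)
qed

section \<open>The one-dimensional case\<close>

text \<open>Meant for times at which the solution touches \<open>a\<close> or \<open>b\<close>: it
  differentiates the truncated curve and its velocity whatever side the solution comes from or goes
  to.\<close>

lemma has_vector_derivative_zero_dominated:
  fixes f :: "real \<Rightarrow> 'a::real_normed_vector" and g :: "real \<Rightarrow> 'b::real_normed_vector"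
  assumes "(f has_vector_derivative 0) (at t)"
    and "\<And>s. norm (g s - g t) \<le> norm (f s - f t)"
  shows "(g has_vector_derivative 0) (at t)"
proof -
  have "\<exists>d>0. \<forall>y. norm (y - t) < d \<longrightarrow> norm (f y - f t) \<le> e * norm (y - t)" if "0 < e" for e
    using assms(1) that unfolding has_vector_derivative_def has_derivative_at_alt by simp
  then show ?thesis
    unfolding has_vector_derivative_def has_derivative_at_alt
    by simp (meson assms(2) order_trans)
qed

definition clamp1 :: "real \<Rightarrow> real \<Rightarrow> real \<Rightarrow> real" where
  "clamp1 a b x = max a (min b x)"

lemma clamp1_diff_le: "\<bar>clamp1 a b x - clamp1 a b y\<bar> \<le> \<bar>x - y\<bar>"
  unfolding clamp1_def by linarith

lemma clamp1_inside: "a \<le> x \<Longrightarrow> x \<le> b \<Longrightarrow> clamp1 a b x = x"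
  by (simp add: clamp1_def)

lemma clamp1_outside: "a < b \<Longrightarrow> x \<notin> {a<..<b} \<Longrightarrow> clamp1 a b x = a \<or> clamp1 a b x = b"
  unfolding clamp1_def by (cases "x \<le> a") auto

text \<open>A chain rule with an inner function that may have a corner: the outer derivative is
  zero, so the Lipschitz bound on \<open>c\<close> is enough.\<close>

lemma has_real_derivative_zero_contraction:
  fixes f c :: "real \<Rightarrow> real"
  assumes f: "(f has_real_derivative 0) (at (c x))" and c: "\<And>y. \<bar>c y - c x\<bar> \<le> \<bar>y - x\<bar>"
  shows "((\<lambda>y. f (c y)) has_real_derivative 0) (at x)"
proof -
  have "\<exists>d>0. \<forall>y. norm (y - x) < d \<longrightarrow> norm (f (c y) - f (c x)) \<le> e * norm (y - x)" if e: "0 < e" for e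
  proof -
    have "(*) (0::real) = (\<lambda>h. 0)" by (simp add: fun_eq_iff)
    then obtain d where d: "0 < d" "\<And>z. norm (z - c x) < d \<Longrightarrow> norm (f z - f (c x)) \<le> e * norm (z - c x)"
      using f e unfolding has_field_derivative_def has_derivative_at_alt by auto
    have "norm (f (c y) - f (c x)) \<le> e * norm (y - x)" if "norm (y - x) < d" for y
    proof -
      have "norm (f (c y) - f (c x)) \<le> e * norm (c y - c x)"
        using d(2)[of "c y"] c[of y] that by simp
      also have "\<dots> \<le> e * norm (y - x)" using c[of y] e by simp
      finally show ?thesis .
    qed
    then show ?thesis using d(1) by blast
  qed
  moreover have "(*) (0::real) = (\<lambda>h. 0)" by (simp add: fun_eq_iff)
  ultimately show ?thesis
    unfolding has_field_derivative_def has_derivative_at_alt by simp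
qed

text \<open>The corners of the clamping map sit over \<open>a\<close> and \<open>b\<close>, where
  \<open>f'\<close> vanishes. This is how criticality of the end points makes the modified potential
  differentiable.\<close>

lemma has_real_derivative_clamp1:
  assumes f: "\<And>x. (f has_real_derivative f' x) (at x)" and ab: "a < b"
    and f'0: "f' a = 0" "f' b = 0"
  shows "((\<lambda>x. f (clamp1 a b x)) has_real_derivative f' (clamp1 a b x)) (at x)"
proof (cases "x \<in> {a<..<b}")
  case True
  have "((\<lambda>x. f (clamp1 a b x)) has_real_derivative f' x) (at x)"
    by (rule has_field_derivative_transform_within_open[OF f[of x] open_greaterThanLessThan[of a b]])
      (use True in \<open>auto simp: clamp1_inside\<close>)
  then show ?thesis using True by (simp add: clamp1_inside)
next
  case False
  then have 0: "f' (clamp1 a b x) = 0" using clamp1_outside[OF ab False] f'0 by auto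
  have "((\<lambda>x. f (clamp1 a b x)) has_real_derivative 0) (at x)"
    using f[of "clamp1 a b x"] has_real_derivative_zero_contraction[of f "clamp1 a b" x, OF _ clamp1_diff_le]
    by (simp add: 0)
  then show ?thesis by (simp only: 0)
qed

lemma has_real_derivative_max_0_sq:
  "((\<lambda>x::real. (max 0 x)\<^sup>2) has_real_derivative 2 * max 0 x) (at x)"
proof -
  consider "x < 0" | "x = 0" | "0 < x" by linarith
  then show ?thesis
  proof cases
    case 1
    have "((\<lambda>x::real. (max 0 x)\<^sup>2) has_real_derivative 0) (at x)"
      by (rule has_field_derivative_transform_within_open[of "\<lambda>_. 0" _ _ "{..<0}"]) (use 1 in auto)
    then show ?thesis using 1 by simp
  next
    case 2
    have "((\<lambda>x::real. x\<^sup>2) has_real_derivative 0) (at (max 0 0))" by (auto intro!: derivative_eq_intros)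
    then have "((\<lambda>x::real. (max 0 x)\<^sup>2) has_real_derivative 0) (at 0)"
      by (rule has_real_derivative_zero_contraction) auto
    then show ?thesis using 2 by simp
  next
    case 3
    have "((\<lambda>x::real. (max 0 x)\<^sup>2) has_real_derivative 2 * x) (at x)"
      by (rule has_field_derivative_transform_within_open[of "\<lambda>x. x\<^sup>2" _ _ "{0<..}"])
        (use 3 in \<open>auto intro!: derivative_eq_intros\<close>)
    then show ?thesis using 3 by simp
  qed
qed

text \<open>Outside \<open>[a, b]\<close> the potential is replaced by the squared distance to the interval, which makes
  it proper; clamping a heteroclinic of the new potential to \<open>[a, b]\<close> gives one of the old potential,
  because by conservation of energy the velocity vanishes whenever the solution meets \<open>a\<close> or \<open>b\<close>.\<close>

lemma heteroclinic_exists_interval: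
  fixes f f' :: "real \<Rightarrow> real"
  assumes f: "\<And>x. (f has_real_derivative f' x) (at x)" and cf': "continuous_on UNIV f'"
    and ab: "a < b" and pos: "\<And>x. a < x \<Longrightarrow> x < b \<Longrightarrow> 0 < f x"
    and f0: "f a = 0" "f b = 0" and f'0: "f' a = 0" "f' b = 0" and p: "p \<in> {a, b}"
  obtains q u v where "q \<in> {a, b}" "q \<noteq> p"
    "\<And>t. (u has_real_derivative v t) (at t)"
    "\<And>t. (v has_real_derivative f' (u t)) (at t)"
    "\<And>t. 1/2 * (v t)\<^sup>2 - f (u t) = 0"
    "(u \<longlongrightarrow> p) at_bot" "(u \<longlongrightarrow> q) at_top"
proof -
  define D where "D x = (max 0 (x - b))\<^sup>2 + (max 0 (a - x))\<^sup>2" for x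
  define D' where "D' x = 2 * max 0 (x - b) - 2 * max 0 (a - x)" for x
  have dD: "(D has_real_derivative D' x) (at x)" for x
  proof -
    have "((\<lambda>x. (max 0 (x - b))\<^sup>2) has_real_derivative 2 * max 0 (x - b) * 1) (at x)"
      by (rule DERIV_chain2[OF has_real_derivative_max_0_sq]) (auto intro!: derivative_eq_intros)
    moreover have "((\<lambda>x. (max 0 (a - x))\<^sup>2) has_real_derivative 2 * max 0 (a - x) * (-1)) (at x)"
      by (rule DERIV_chain2[OF has_real_derivative_max_0_sq]) (auto intro!: derivative_eq_intros)
    ultimately show ?thesis unfolding D_def[abs_def] D'_def using DERIV_add by fastforce
  qed
  have Dnn: "0 \<le> D x" for x by (simp add: D_def)
  have fnn: "0 \<le> f (clamp1 a b x)" for x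
    using pos[of "clamp1 a b x"] f0 clamp1_outside[OF ab, of x] clamp1_inside[of a x b]
    by (cases "x \<in> {a<..<b}") (auto simp: less_imp_le)
  define V where "V x = f (clamp1 a b x) + D x" for x
  define g where "g x = f' (clamp1 a b x) + D' x" for x
  \<comment> \<open>Half the squared distance to the interval is proper, and its squared slope is
    \<open>D x\<close>, which is at most \<open>2 * V x\<close>.\<close>
  interpret multiwell V g "\<lambda>x. D x / 2" "\<lambda>x. D' x / 2" "{a, b}"
  proof
    fix x
    show "GDERIV V x :> g x"
      unfolding V_def[abs_def] g_def gderiv_deriv by (intro DERIV_add dD has_real_derivative_clamp1 f ab f'0)
    show "0 \<le> V x" using Dnn fnn by (simp add: V_def)
    show "V x = 0 \<longleftrightarrow> x \<in> {a, b}"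
    proof (cases "x \<in> {a..b}")
      case True
      then have "V x = f x" by (simp add: V_def D_def clamp1_inside)
      then show ?thesis using pos[of x] f0 True by force
    next
      case False
      then have "0 < D x" unfolding D_def by (cases "x < a") (auto intro: add_nonneg_pos add_pos_nonneg)
      then show ?thesis using fnn[of x] False ab by (auto simp: V_def)
    qed
    show "GDERIV (\<lambda>x. D x / 2) x :> D' x / 2"
      unfolding gderiv_deriv by (intro DERIV_cdivide dD)
    have "(D' x / 2)\<^sup>2 = D x"
      using ab by (cases "x \<le> a"; cases "x \<ge> b") (auto simp: D_def D'_def power2_eq_square max_def field_simps)
    then have "(norm (D' x / 2))\<^sup>2 = D x" by (simp only: real_norm_def power2_abs)
    then show "(norm (D' x / 2))\<^sup>2 \<le> 2 * V x" using Dnn[of x] fnn[of x] by (simp add: V_def)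
  next
    show "continuous_on UNIV g"
      unfolding g_def D'_def clamp1_def
      by (intro continuous_intros continuous_on_compose2[OF cf']) auto
    fix c
    have "\<bar>x\<bar> \<le> \<bar>a\<bar> + \<bar>b\<bar> + \<bar>2 * c\<bar> + 1" if "D x / 2 \<le> c" for x
    proof (rule ccontr)
      assume far: "\<not> ?thesis"
      have sq: "2 * c < z\<^sup>2" if "\<bar>2 * c\<bar> + 1 \<le> z" for z
      proof -
        have "1 * z \<le> z * z" using that by (intro mult_right_mono) auto
        then show ?thesis using that unfolding power2_eq_square by linarith
      qed
      have "2 * c < D x"
      proof (cases "x < 0")
        case True
        then have y: "\<bar>2 * c\<bar> + 1 \<le> a - x" using far by linarith
        then have "(a - x)\<^sup>2 \<le> D x" by (simp add: D_def max_def)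
        then show ?thesis using sq[OF y] by linarith
      next
        case False
        then have y: "\<bar>2 * c\<bar> + 1 \<le> x - b" using far by linarith
        then have "(x - b)\<^sup>2 \<le> D x" by (simp add: D_def max_def)
        then show ?thesis using sq[OF y] by linarith
      qed
      then show False using that by simp
    qed
    then show "bounded {x. D x / 2 \<le> c}" by (auto simp: bounded_iff)
  qed simp
  obtain q0 where q0: "q0 \<in> {a, b}" "q0 \<noteq> p" using p ab by auto
  obtain q u v where q: "q \<in> {a, b}" "q \<noteq> p"
    and u: "\<And>t. (u has_vector_derivative v t) (at t)"
    and v: "\<And>t. (v has_vector_derivative g (u t)) (at t)"
    and en: "\<And>t. 1/2 * (norm (v t))\<^sup>2 - V (u t) = 0"
    and lim: "(u \<longlongrightarrow> p) at_bot" "(u \<longlongrightarrow> q) at_top"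
    using heteroclinic_exists[OF p q0] by blast
  define y where "y t = clamp1 a b (u t)" for t
  define w where "w t = (if u t \<in> {a<..<b} then v t else 0)" for t
  have cu: "continuous_on UNIV u"
    using u by (intro continuous_at_imp_continuous_on ballI has_vector_derivative_continuous) auto
  have opn: "open {t. u t \<in> S}" if "open S" for S
    using open_vimage[OF that cu] by (simp add: vimage_def)
  have "(y has_vector_derivative w t) (at t) \<and> (w has_vector_derivative f' (y t)) (at t) \<and>
      1/2 * (w t)\<^sup>2 - f (y t) = 0" for t
  proof -
    \<comment> \<open>In the first two cases \<open>u\<close> stays in an open set for nearby times,
      so \<open>y\<close> and \<open>w\<close> agree locally with the solution or with constants.
      Contact with an end is the delicate case and is settled by domination.\<close>
    consider "u t \<in> {a<..<b}" | c S where "u t \<in> S" "open S" "c \<in> {a, b}"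
        "\<And>s. u s \<in> S \<Longrightarrow> y s = c" "\<And>s. u s \<in> S \<Longrightarrow> w s = 0" | "u t \<in> {a, b}"
    proof -
      have 1: "y s = a" "w s = 0" if "u s \<in> {..<a}" for s
        using that ab by (auto simp: y_def w_def clamp1_def)
      have 2: "y s = b" "w s = 0" if "u s \<in> {b<..}" for s
        using that ab by (auto simp: y_def w_def clamp1_def)
      have "u t \<in> {a<..<b} \<or> u t \<in> {..<a} \<or> u t \<in> {b<..} \<or> u t \<in> {a, b}" by force
      then show ?thesis
      proof (elim disjE)
        assume "u t \<in> {..<a}"
        then show ?thesis by (rule that(2)[of "{..<a}" a]) (use 1 in auto)
      next
        assume "u t \<in> {b<..}"
        then show ?thesis by (rule that(2)[of "{b<..}" b]) (use 2 in auto)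
      qed (fact that)+
    qed
    then show ?thesis
    proof cases
      case 1
      have "(y has_vector_derivative v t) (at t)"
        by (rule has_vector_derivative_transform_within_open[OF u opn[of "{a<..<b}"]])
          (use 1 in \<open>auto simp: y_def clamp1_inside\<close>)
      moreover have "(w has_vector_derivative g (u t)) (at t)"
        by (rule has_vector_derivative_transform_within_open[OF v opn[of "{a<..<b}"]])
          (use 1 in \<open>auto simp: w_def\<close>)
      moreover have "g (u t) = f' (y t)" "V (u t) = f (y t)"
        using 1 by (auto simp: g_def V_def y_def D_def D'_def)
      ultimately show ?thesis using en[of t] 1 by (simp add: w_def)
    next
      case 2
      have "(y has_vector_derivative 0) (at t)"
        by (rule has_vector_derivative_transform_within_open[of "\<lambda>_. c" _ _ "{t. u t \<in> S}"])
          (use 2 opn in auto)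
      moreover have "(w has_vector_derivative 0) (at t)"
        by (rule has_vector_derivative_transform_within_open[of "\<lambda>_. 0" _ _ "{t. u t \<in> S}"])
          (use 2 opn in auto)
      moreover have "w t = 0" "f (y t) = 0" "f' (y t) = 0" using 2 f0 f'0 by auto
      ultimately show ?thesis by simp
    next
      case 3
      have "v t = 0" using en[of t] U_eq_0_iff[of "u t"] 3 by simp
      moreover have "g (u t) = 0"
        using 3 ab f'0 by (auto simp: g_def D'_def clamp1_inside)
      ultimately have du: "(u has_vector_derivative 0) (at t)" and dv: "(v has_vector_derivative 0) (at t)"
        using u[of t] v[of t] by auto
      have "(y has_vector_derivative 0) (at t)"
        by (rule has_vector_derivative_zero_dominated[OF du]) (simp add: y_def clamp1_diff_le)
      moreover have "w t = 0" using 3 by (auto simp: w_def)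
      \<comment> \<open>Each \<open>w s\<close> is either \<open>v s\<close> or 0, and both
        \<open>v t\<close> and \<open>w t\<close> are 0, so increments of \<open>w\<close> are
        dominated by those of \<open>v\<close>.\<close>
      moreover have "(w has_vector_derivative 0) (at t)"
        by (rule has_vector_derivative_zero_dominated[OF dv]) (use \<open>v t = 0\<close> \<open>w t = 0\<close> in \<open>simp add: w_def\<close>)
      moreover have "f (y t) = 0" "f' (y t) = 0"
        using 3 ab f0 f'0 by (auto simp: y_def clamp1_inside)
      ultimately show ?thesis by simp
    qed
  qed
  then have sol: "(y has_real_derivative w t) (at t)" "(w has_real_derivative f' (y t)) (at t)"
    "1/2 * (w t)\<^sup>2 - f (y t) = 0" for t
    by (simp_all add: has_real_derivative_iff_has_vector_derivative)
  have "(y \<longlongrightarrow> clamp1 a b x) F" if "(u \<longlongrightarrow> x) F" for x F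
    unfolding y_def clamp1_def by (intro tendsto_intros that)
  moreover have "clamp1 a b x = x" if "x \<in> {a, b}" for x using that ab by (auto simp: clamp1_inside)
  ultimately have "(y \<longlongrightarrow> p) at_bot" "(y \<longlongrightarrow> q) at_top" using lim p q(1) by metis+
  with q sol show ?thesis by (intro that[of q y w])
qed

text \<open>A point of \<open>I\<close> at or beyond one of the two ends, together with points of
  \<open>I\<close> close to the other end, would force that end into \<open>I\<close> by
  convexity.\<close>

lemma open_connected_eq_greaterThanLessThan:
  fixes I :: "real set"
  assumes I: "connected I" and ab: "a < b" and out: "a \<notin> I" "b \<notin> I"
    and cl: "a \<in> closure I" "b \<in> closure I"
  shows "I = {a<..<b}"
proof -
  have ivl: "z \<in> I" if "x \<in> I" "y \<in> I" "x \<le> z" "z \<le> y" for x y z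
    using I that unfolding connected_iff_interval by blast
  have nearby: "\<exists>s\<in>I. \<bar>s - c\<bar> < d" if "c \<in> closure I" "0 < d" for c d
    using that unfolding closure_approachable dist_real_def by blast
  obtain s where s: "s \<in> I" "\<bar>s - a\<bar> < b - a" using nearby[OF cl(1), of "b - a"] ab by auto
  obtain s' where s': "s' \<in> I" "\<bar>s' - b\<bar> < b - a" using nearby[OF cl(2), of "b - a"] ab by auto
  have sa: "s < b" "a < s'" using s s' by linarith+
  have gt: "a < x" if "x \<in> I" for x
  proof (rule ccontr)
    assume "\<not> a < x"
    then show False using ivl[OF that s'(1), of a] sa out by simp
  qed
  have lt: "x < b" if "x \<in> I" for x
  proof (rule ccontr)
    assume "\<not> x < b"
    then show False using ivl[OF s(1) that, of b] sa out by simp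
  qed
  have "x \<in> I" if x: "a < x" "x < b" for x
  proof -
    obtain y where y: "y \<in> I" "\<bar>y - a\<bar> < x - a" using nearby[OF cl(1), of "x - a"] x by auto
    obtain z where z: "z \<in> I" "\<bar>z - b\<bar> < b - x" using nearby[OF cl(2), of "b - x"] x by auto
    show ?thesis by (rule ivl[OF y(1) z(1)]) (use y z in linarith)+
  qed
  then show ?thesis using gt lt by auto
qed

text \<open>The coordinate along the only basis vector \<open>e\<close> identifies the space with
  the reals. As \<open>p\<close> and \<open>q0\<close> lie in the closure of the connected set
  \<open>\<Omega>\<close> but not in it, \<open>\<Omega>\<close> becomes the open interval between
  them, whichever of the two comes first.\<close>

lemma heteroclinic_exists_dim1:
  fixes U :: "'a::euclidean_space \<Rightarrow> real"
  assumes dim: "DIM('a) = 1" and G: "\<And>x. GDERIV U x :> G x" "continuous_on UNIV G"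
    and \<Omega>: "connected \<Omega>" "\<Omega> \<subseteq> {x. U x > 0}" "\<Omega> \<inter> frontier \<Omega> = {}"
    and U0: "\<And>p. p \<in> frontier \<Omega> \<Longrightarrow> U p = 0" and G0: "\<And>p. p \<in> frontier \<Omega> \<Longrightarrow> G p = 0"
    and p: "p \<in> frontier \<Omega>" and q0: "q0 \<in> frontier \<Omega>" "q0 \<noteq> p"
  obtains q u v where "q \<in> frontier \<Omega>" "q \<noteq> p"
    "\<And>t. (u has_vector_derivative v t) (at t)"
    "\<And>t. (v has_vector_derivative G (u t)) (at t)"
    "\<And>t. 1/2 * (norm (v t))\<^sup>2 - U (u t) = 0"
    "(u \<longlongrightarrow> p) at_bot" "(u \<longlongrightarrow> q) at_top"
proof -
  obtain e :: 'a where B: "Basis = {e}" using dim by (rule card_1_singletonE)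
  have ee: "e \<bullet> e = 1" by (rule inner_same_Basis) (simp add: B)
  have rep: "(x \<bullet> e) *\<^sub>R e = x" for x using euclidean_representation[of x] by (simp add: B)
  define I where "I = (\<lambda>s. s *\<^sub>R e) -` \<Omega>"
  have II: "I = (\<lambda>x. x \<bullet> e) ` \<Omega>" using rep ee by (force simp: I_def image_iff)
  have "connected I" unfolding II by (intro connected_continuous_image continuous_intros \<Omega>)
  define a b where "a = min (p \<bullet> e) (q0 \<bullet> e)" and "b = max (p \<bullet> e) (q0 \<bullet> e)"
  have "p \<bullet> e \<noteq> q0 \<bullet> e" using rep[of p] rep[of q0] q0(2) by metis
  then have ab: "a < b" and pab: "p \<bullet> e \<in> {a, b}" by (auto simp: a_def b_def)
  have abF: "x *\<^sub>R e \<in> frontier \<Omega>" if "x \<in> {a, b}" for x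
    using that p q0 rep by (auto simp: a_def b_def min_def max_def)
  have "x \<notin> I \<and> x \<in> closure I" if "x \<in> {a, b}" for x
  proof -
    have F: "x *\<^sub>R e \<in> frontier \<Omega>" by (rule abF[OF that])
    have "(\<lambda>x. x \<bullet> e) ` closure \<Omega> \<subseteq> closure I"
      unfolding II by (intro continuous_image_closure_subset[of UNIV] continuous_intros) auto
    moreover have "x *\<^sub>R e \<in> closure \<Omega>" using F by (simp add: frontier_def)
    ultimately have "(x *\<^sub>R e) \<bullet> e \<in> closure I" by blast
    then show ?thesis using F \<Omega>(3) ee by (auto simp: I_def)
  qed
  then have Iab: "I = {a<..<b}"
    by (intro open_connected_eq_greaterThanLessThan ab \<open>connected I\<close>) auto
  define f where "f s = U (s *\<^sub>R e)" for s
  define f' where "f' s = G (s *\<^sub>R e) \<bullet> e" for s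
  have df: "(f has_real_derivative f' s) (at s)" for s
  proof -
    have "((\<lambda>s. s *\<^sub>R e) has_vector_derivative e) (at s)"
      by (auto intro!: derivative_eq_intros simp: has_vector_derivative_def)
    then have "((\<lambda>s. U (s *\<^sub>R e)) has_vector_derivative e \<bullet> G (s *\<^sub>R e)) (at s)"
      by (rule GDERIV_vector_chain[OF G(1)])
    then show ?thesis
      by (simp add: f_def[abs_def] f'_def has_real_derivative_iff_has_vector_derivative inner_commute)
  qed
  have cf': "continuous_on UNIV f'"
    unfolding f'_def by (intro continuous_intros continuous_on_compose2[OF G(2)]) auto
  have fpos: "0 < f x" if "a < x" "x < b" for x
    using Iab \<Omega>(2) that by (auto simp: f_def I_def)
  have f0: "f a = 0" "f b = 0" "f' a = 0" "f' b = 0"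
    using abF U0 G0 by (auto simp: f_def f'_def)
  obtain q u v where q: "q \<in> {a, b}" "q \<noteq> p \<bullet> e"
    and u: "\<And>t. (u has_real_derivative v t) (at t)"
    and v: "\<And>t. (v has_real_derivative f' (u t)) (at t)"
    and en: "\<And>t. 1/2 * (v t)\<^sup>2 - f (u t) = 0"
    and lim: "(u \<longlongrightarrow> p \<bullet> e) at_bot" "(u \<longlongrightarrow> q) at_top"
    using heteroclinic_exists_interval[OF df cf' ab fpos f0 pab] by blast
  show ?thesis
  proof (rule that[of "q *\<^sub>R e" "\<lambda>t. u t *\<^sub>R e" "\<lambda>t. v t *\<^sub>R e"])
    show "q *\<^sub>R e \<in> frontier \<Omega>" by (rule abF[OF q(1)])
    show "q *\<^sub>R e \<noteq> p" using q(2) ee by auto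
    fix t
    have sc: "((\<lambda>t. h t *\<^sub>R e) has_vector_derivative h' *\<^sub>R e) (at t)"
      if "(h has_real_derivative h') (at t)" for h h'
      using bounded_linear.has_vector_derivative[OF bounded_linear_scaleR_left] that
      by (simp add: has_real_derivative_iff_has_vector_derivative)
    show "((\<lambda>t. u t *\<^sub>R e) has_vector_derivative v t *\<^sub>R e) (at t)" by (rule sc[OF u])
    show "((\<lambda>t. v t *\<^sub>R e) has_vector_derivative G (u t *\<^sub>R e)) (at t)"
      using sc[OF v[of t]] rep[of "G (u t *\<^sub>R e)"] by (simp add: f'_def)
    have "norm e = 1" using ee by (simp add: norm_eq_sqrt_inner)
    then show "1/2 * (norm (v t *\<^sub>R e))\<^sup>2 - U (u t *\<^sub>R e) = 0"
      using en[of t] by (simp add: f_def)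
  next
    show "((\<lambda>t. u t *\<^sub>R e) \<longlongrightarrow> p) at_bot"
      using tendsto_scaleR[OF lim(1) tendsto_const[of e]] rep[of p] by simp
    show "((\<lambda>t. u t *\<^sub>R e) \<longlongrightarrow> q *\<^sub>R e) at_top"
      by (intro tendsto_scaleR lim tendsto_const)
  qed
qed

section \<open>Reduction to the cases \<open>n = 1\<close> and \<open>n \<ge> 2\<close>\<close>

theorem corollary1p3:
  fixes U :: "real ^ 'n \<Rightarrow> real"
    and \<Omega> P :: "(real ^ 'n) set"
  assumes "class_C2 U"
    and "\<Omega> \<in> components {x. U x > 0}"
    and "frontier \<Omega> = P"
    and "finite P"
    and "card P \<ge> 2"
    and "\<forall>p\<in>P. critical_point U p"
    and "\<not> bounded \<Omega> \<longrightarrow>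
      (\<exists>(r\<^sub>0::real) (\<sigma> :: real \<Rightarrow> real).
         r\<^sub>0 > 0 \<and> (\<forall>r\<ge>r\<^sub>0. \<sigma> r \<ge> 0) \<and>
         \<sigma> \<in> borel_measurable (lebesgue_on {r\<^sub>0..}) \<and>
         (\<integral>\<^sup>+ r. ennreal (\<sigma> r) \<partial>lebesgue_on {r\<^sub>0..}) = \<infinity> \<and>
         (\<forall>x\<in>\<Omega>. norm x \<ge> r\<^sub>0 \<longrightarrow> sqrt (U x) \<ge> \<sigma> (norm x)))"
  shows "\<forall>p\<in>P. \<exists>q\<in>P - {p}. \<exists>u. heteroclinic_connection U p q u"
proof
  fix p assume p: "p \<in> P"
  obtain G where G: "\<And>x. GDERIV U x :> G x" "continuous_on UNIV G"
    using class_C2_gradient[OF assms(1)] by blast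
  have cU: "continuous_on UNIV U" by (rule GDERIV_imp_continuous_on[OF G(1)])
  note \<Omega> = component_pos_set[OF cU assms(2)]
  have "P - {p} \<noteq> {}" using assms(5) card_mono[of "{p}" P] by force
  then obtain q0 where q0: "q0 \<in> P" "q0 \<noteq> p" by blast
  have G0: "G x = 0" if "x \<in> P" for x
    using assms(6) that GDERIV_unique[OF G(1)] unfolding critical_point_def by blast
  have "\<exists>q\<in>P - {p}. \<exists>u v. (\<forall>t. (u has_vector_derivative v t) (at t)) \<and>
      (\<forall>t. (v has_vector_derivative G (u t)) (at t)) \<and>
      (\<forall>t. 1/2 * (norm (v t))\<^sup>2 - U (u t) = 0) \<and> (u \<longlongrightarrow> p) at_bot \<and> (u \<longlongrightarrow> q) at_top"
  proof (cases "DIM(real ^ 'n) = 1")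
    case True
    show ?thesis
      using heteroclinic_exists_dim1[OF True G \<Omega>(1-4)] assms(3) G0 p q0 by (metis Diff_iff singletonD)
  next
    case False
    then have dim: "2 \<le> DIM(real ^ 'n)" using DIM_positive[where 'a = "real ^ 'n"] by linarith
    have \<Omega>P: "\<Omega> = - P"
      using complement_of_finite_frontier[OF dim, of \<Omega>] assms(3,4) \<Omega>(3) in_components_nonempty[OF assms(2)]
      by simp
    \<comment> \<open>The complement of a finite set is unbounded, so the radial lower bound becomes
      available.\<close>
    have "\<not> bounded \<Omega>"
      using \<Omega>P assms(4) finite_imp_bounded cobounded_imp_unbounded by metis
    then obtain r\<^sub>0 \<sigma> where "r\<^sub>0 > 0"
      and int: "(\<integral>\<^sup>+ r. ennreal (\<sigma> r) \<partial>lebesgue_on {r\<^sub>0..}) = \<infinity>"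
      and \<sigma>: "\<forall>x\<in>\<Omega>. norm x \<ge> r\<^sub>0 \<longrightarrow> sqrt (U x) \<ge> \<sigma> (norm x)"
      using assms(7) by blast
    \<comment> \<open>\<open>U\<close> is positive on \<open>\<Omega>\<close> and zero on its
      frontier, and these two sets now cover the space.\<close>
    have U0: "U x = 0 \<longleftrightarrow> x \<in> P" and Unn: "0 \<le> U x" for x
      using \<Omega>(2,4) \<Omega>P assms(3) by (cases "x \<in> P"; force)+
    obtain \<Phi> \<Psi> where "multiwell U G \<Phi> \<Psi> P"
      using multiwell_of_radial_bound[OF G Unn U0 assms(4) \<open>r\<^sub>0 > 0\<close> _ int] \<sigma> \<Omega>P by blast
    then interpret multiwell U G \<Phi> \<Psi> P .
    show ?thesis
      using heteroclinic_exists[OF p q0] by (metis Diff_iff singletonD)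
  qed
  then show "\<exists>q\<in>P - {p}. \<exists>u. heteroclinic_connection U p q u"
    unfolding heteroclinic_connection_def using gradient_eqI[OF G(1)] by (metis (no_types, lifting))
qed

end
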